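(* (Further cubature formulas related to $\mathcal{P}^{I,+}_k$) Let $n$ be a positive integer. (1) For any positive integer $N$ and any polynomial $f\in\mathbb{R}[Y_1,\dots,Y_n]$ of degree at most $2N-1$, $$\int_{\mathfrak{F}}f(Y)\,\omega^{I,+}(Y)\,dY=\left(\frac{1}{N}\right)^n\sum_{Y\in \mathfrak{F}_N^{\mathrm{I},+}}\mathcal{E}_Y\mathcal{H}_Y^{-1}f(Y).$$ (2) For any integer $N\ge2$ and any polynomial $f\in\mathbb{R}[Y_1,\dots,Y_n]$ of degree at most $2(N-1)$, $$\int_{\mathfrak{F}}f(Y)\,\omega^{I,+}(Y)\,dY=\left(\frac{2}{2N-1}\right)^n\sum_{Y\in \mathfrak{F}_N^{\mathrm{V},+}}\mathcal{E}_Y\mathcal{H}_Y^{-1}f(Y),$$ $$\int_{\mathfrak{F}}f(Y)\,\omega^{I,+}(Y)\,dY=\left(\frac{2}{2N-1}\right)^n\sum_{Y\in \mathfrak{F}_N^{\mathrm{VI},+}}\widetilde{\mathcal{E}}_Y\mathcal{H}_Y^{-1}f(Y).$$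
   Context: For $\lambda,x\in\mathbb{R}^n$: $\cos^+_\lambda(x)=\sum_{\sigma\in S_n}\prod_{i=1}^n\cos(\pi\lambda_{\sigma(i)}x_i)$. $F=\{x\in\mathbb{R}^n : 1\ge x_1\ge x_2\ge\dots\ge x_n\ge0\}$. Let $X_j(x)=\cos^+_{(1,\dots,1,0,\dots,0)}(x)$ with $j$ ones and $n-j$ zeros, $j=1,\dots,n$; let $\varphi(x)=(X_1(x),\dots,X_n(x))$ for $x\in F$ and $\mathfrak{F}=\varphi(F)$. The map $\varphi$ is injective on $F$. Let $J(x)=\det\frac{\partial(X_1,\dots,X_n)}{\partial(x_1,\dots,x_n)}$. Then $J(x)^2=p^{I,+}(\varphi(x))$ for a polynomial $p^{I,+}$; put $\mathcal{J}(Y)=\sqrt{p^{I,+}(Y)}$ for $Y\in\mathfrak{F}$ (so $\mathcal{J}(\varphi(x))=|J(x)|$ for $x\in F$) and $\omega^{I,+}=1/\mathcal{J}$. For fixed $N$: $c_r=\frac12$ if $r=0$ or $r=N$, and $c_r=1$ otherwise; $D_M^+=\{r\in\mathbb{Z}^n : M-1\ge r_1\ge\dots\ge r_n\ge0\}$. Grids: $F_N^{\mathrm{I},+}=\left\{\left(\frac{r_1}{N},\dots,\frac{r_n}{N}\right): r\in D_{N+1}^+\right\}$, $F_N^{\mathrm{V},+}=\left\{\left(\frac{2r_1}{2N-1},\dots,\frac{2r_n}{2N-1}\right): r\in D_{N}^+\right\}$, $F_N^{\mathrm{VI},+}=\left\{\left(\frac{2(r_1+\frac12)}{2N-1},\dots,\frac{2(r_n+\frac12)}{2N-1}\right):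 r\in D_{N}^+\right\}$, and $\mathfrak{F}_N^{t,+}=\varphi(F_N^{t,+})$. For $Y=\varphi(s)$ with $s$ the grid point labeled by $r$: $\mathcal{H}_Y=H_s=\#\{\sigma\in S_n : (s_{\sigma(1)},\dots,s_{\sigma(n)})=s\}$; $\mathcal{E}_Y=c_{r_1}\cdots c_{r_n}$ (grids I and V); $\widetilde{\mathcal{E}}_Y=c_{r_1+1}\cdots c_{r_n+1}$ (grid VI). *)

theory Defs
  imports "HOL-Analysis.Analysis" "HOL-Library.Poly_Mapping"
begin

text \<open>
  The coordinates \<open>1, \<dots>, n\<close> are the elements of an index type \<open>'n\<close> of class
  \<open>{finite,wellorder}\<close> in increasing order, \<open>n = CARD('n) \<ge> 1\<close>. Every finite linear order
  belongs to this class; it is the one used by \<open>HOL-Analysis.Change_Of_Vars\<close>, and the numeral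
  types provide an instance for every \<open>n\<close>.
\<close>

text \<open>The ring of real polynomials in the variables \<open>Y $ i\<close>: finitely supported
  coefficient functions on exponent vectors.\<close>

type_synonym 'n mvpoly = "('n \<Rightarrow>\<^sub>0 nat) \<Rightarrow>\<^sub>0 real"

definition peval :: "'n::finite mvpoly \<Rightarrow> real^'n \<Rightarrow> real" where
  "peval f Y = (\<Sum>m\<in>Poly_Mapping.keys f.
     Poly_Mapping.lookup f m * (\<Prod>i\<in>UNIV. (Y $ i) ^ Poly_Mapping.lookup m i))"

text \<open>Total degree; the zero polynomial gets degree 0.\<close>

definition total_degree :: "'n::finite mvpoly \<Rightarrow> nat" where
  "total_degree f =
     Max (insert 0 ((\<lambda>m. \<Sum>i\<in>UNIV. Poly_Mapping.lookup m i) ` Poly_Mapping.keys f))"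

definition cos_plus :: "real^'n::finite \<Rightarrow> real^'n \<Rightarrow> real" where
  "cos_plus l x = (\<Sum>\<sigma> | \<sigma> permutes (UNIV :: 'n set). \<Prod>i\<in>UNIV. cos (pi * l $ \<sigma> i * x $ i))"

definition fund_dom :: "(real^'n::{finite,wellorder}) set" where
  "fund_dom = {x. (\<forall>i. 0 \<le> x $ i \<and> x $ i \<le> 1) \<and> (\<forall>i j. i \<le> j \<longrightarrow> x $ j \<le> x $ i)}"

text \<open>If \<open>j\<close> is the \<open>k\<close>-th element of \<open>'n\<close>, the vector below consists of \<open>k\<close> ones followed by
  \<open>n - k\<close> zeros.\<close>

definition X :: "'n::{finite,wellorder} \<Rightarrow> real^'n::_ \<Rightarrow> real" where
  "X j x = cos_plus (\<chi> i. if i \<le> j then 1 else 0) x"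

definition phi :: "real^'n::{finite,wellorder} \<Rightarrow> real^'n::_" where
  "phi x = (\<chi> j. X j x)"

definition Fimg :: "(real^'n::{finite,wellorder}) set" where
  "Fimg = phi ` fund_dom"

definition J :: "real^'n::{finite,wellorder} \<Rightarrow> real" where
  "J x = det (jacobian phi (at x))"

text \<open>The polynomial expressing \<open>J\<^sup>2\<close> through \<open>phi\<close>. It is unique, since \<open>Fimg\<close> has interior
  points, so the choice operator selects nothing arbitrary.\<close>

definition pI :: "'n::{finite,wellorder} mvpoly" where
  "pI = (SOME p. \<forall>x\<in>fund_dom. (J x)\<^sup>2 = peval p (phi x))"

definition calJ :: "real^'n::{finite,wellorder} \<Rightarrow> real" where
  "calJ Y = sqrt (peval pI Y)"

text \<open>On the null set where \<open>calJ\<close> vanishes the weight takes the value 0.\<close>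

definition omegaI :: "real^'n::{finite,wellorder} \<Rightarrow> real" where
  "omegaI Y = 1 / calJ Y"

definition c :: "nat \<Rightarrow> int \<Rightarrow> real" where
  "c N r = (if r = 0 \<or> r = int N then 1/2 else 1)"

definition D :: "nat \<Rightarrow> (int^'n::{finite,wellorder}) set" where
  "D M = {r. (\<forall>i. 0 \<le> r $ i \<and> r $ i \<le> int M - 1) \<and> (\<forall>i j. i \<le> j \<longrightarrow> r $ j \<le> r $ i)}"

text \<open>The grid point labelled by \<open>r\<close>, for the three types of grids.\<close>

definition ptI :: "nat \<Rightarrow> int^'n::{finite,wellorder} \<Rightarrow> real^'n::_" where
  "ptI N r = (\<chi> i. of_int (r $ i) / real N)"

definition ptV :: "nat \<Rightarrow> int^'n::{finite,wellorder} \<Rightarrow> real^'n::_" where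
  "ptV N r = (\<chi> i. 2 * of_int (r $ i) / (2 * real N - 1))"

definition ptVI :: "nat \<Rightarrow> int^'n::{finite,wellorder} \<Rightarrow> real^'n::_" where
  "ptVI N r = (\<chi> i. 2 * (of_int (r $ i) + 1/2) / (2 * real N - 1))"

definition gridI :: "nat \<Rightarrow> (real^'n::{finite,wellorder}) set" where
  "gridI N = ptI N ` D (N + 1)"

definition gridV :: "nat \<Rightarrow> (real^'n::{finite,wellorder}) set" where
  "gridV N = ptV N ` D N"

definition gridVI :: "nat \<Rightarrow> (real^'n::{finite,wellorder}) set" where
  "gridVI N = ptVI N ` D N"

definition H :: "real^'n::{finite,wellorder} \<Rightarrow> nat" where
  "H s = card {\<sigma>. \<sigma> permutes (UNIV :: 'n set) \<and> (\<chi> i. s $ \<sigma> i) = s}"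

text \<open>All grids lie in \<open>fund_dom\<close>, where \<open>phi\<close> is injective; hence the inverses below recover the
  point \<open>s\<close> with \<open>phi s = Y\<close>, and the label \<open>r\<close> of that point.\<close>

definition calH :: "real^'n::{finite,wellorder} \<Rightarrow> nat" where
  "calH Y = H (inv_into fund_dom phi Y)"

definition calE_I :: "nat \<Rightarrow> real^'n::{finite,wellorder} \<Rightarrow> real" where
  "calE_I N Y = (let r = inv_into (D (N + 1)) (\<lambda>r. phi (ptI N r)) Y in \<Prod>i\<in>UNIV. c N (r $ i))"

definition calE_V :: "nat \<Rightarrow> real^'n::{finite,wellorder} \<Rightarrow> real" where
  "calE_V N Y = (let r = inv_into (D N) (\<lambda>r. phi (ptV N r)) Y in \<Prod>i\<in>UNIV. c N (r $ i))"

definition calE_VI :: "nat \<Rightarrow> real^'n::{finite,wellorder} \<Rightarrow> real" where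
  "calE_VI N Y = (let r = inv_into (D N) (\<lambda>r. phi (ptVI N r)) Y in \<Prod>i\<in>UNIV. c N (r $ i + 1))"

text \<open>\<open>weighted_integral_eq f v\<close>: the Lebesgue integral of \<open>f \<cdot> omegaI\<close> over \<open>Fimg\<close> exists and has
  the value \<open>v\<close>.\<close>

definition weighted_integral_eq :: "'n::{finite,wellorder} mvpoly \<Rightarrow> real \<Rightarrow> bool" where
  "weighted_integral_eq f v \<longleftrightarrow>
     set_integrable lebesgue Fimg (\<lambda>Y. peval f Y * omegaI Y) \<and>
     (LINT Y:Fimg|lebesgue. peval f Y * omegaI Y) = v"

end

theory Submission
  imports Defs "HOL-Computational_Algebra.Polynomial"
begin

text \<open>
  The idea is to pull everything back along \<open>phi\<close> and then to recognize a product of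
  one-dimensional quadrature rules.

  The coordinate \<open>X j\<close> of \<open>phi\<close> is a positive multiple of an elementary symmetric function of the cosines
  \<open>cos (pi * x $ i)\<close>, that is, of a coefficient of \<open>\<Prod>i. z + cos (pi * x $ i)\<close>
  (\<open>X_conv_coeff\<close>). Hence \<open>phi x\<close> determines the multiset of the
  cosines, and \<open>phi\<close> is injective on the fundamental domain (\<open>inj_on_phi\<close>). The Jacobian is nonzero
  off finitely many hyperplanes (\<open>J_nonzero\<close>), and its square is a polynomial in the
  \<open>X j\<close> by Newton's identities (\<open>phi_poly_J_square\<close>), so that the weight \<open>omegaI\<close> at \<open>phi x\<close> is the
  reciprocal of the absolute Jacobian. Change of variables turns the weighted integral of
  \<open>f\<close> into the unweighted integral of \<open>f (phi x)\<close> over the fundamental domain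
  (\<open>weighted_integral_eq_fund_dom\<close>).

  As \<open>f (phi x)\<close> is symmetric, this integral is \<open>1 / n!\<close> times the integral over the cube
  (\<open>integral_cube_symmetric\<close>), and in the same way a sum over the grid points in the
  fundamental domain, weighted by \<open>1 / H\<close>, is \<open>1 / n!\<close> times the sum over the full product grid
  (\<open>sum_over_orbits\<close>). Both rest on the fact that an orbit meets the fundamental domain in one
  point. On the cube, \<open>f (phi x)\<close> is a combination of products of powers of the single cosines with
  exponents at most the degree of \<open>f\<close> (\<open>cos_span_peval_phi\<close>), because each \<open>X j\<close> is multilinear. So it is
  enough that the rule in one variable is exact for \<open>cos (pi * t) ^ k\<close> with \<open>k\<close> up to that
  degree (\<open>cubature_on_fund_dom\<close>). For the three grids this is the exactness of equally
  spaced nodes for trigonometric polynomials (\<open>trapezoid_rule_vanishes\<close>, \<open>odd_rules_vanish\<close>).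
\<close>

section \<open>Polynomial functions of the fundamental characters\<close>

lemma peval_superset:
  assumes "finite K" "Poly_Mapping.keys f \<subseteq> K"
  shows "peval f Y = (\<Sum>m\<in>K. Poly_Mapping.lookup f m * (\<Prod>i\<in>UNIV. (Y $ i) ^ Poly_Mapping.lookup m i))"
  unfolding peval_def
  by (rule sum.mono_neutral_left) (use assms in \<open>auto simp: in_keys_iff\<close>)

lemma peval_0 [simp]: "peval 0 Y = 0"
  by (simp add: peval_def)

lemma peval_single:
  "peval (Poly_Mapping.single m a) Y = a * (\<Prod>i\<in>UNIV. (Y $ i) ^ Poly_Mapping.lookup m i)"
  by (subst peval_superset[of "{m}"]) auto

lemma peval_add [simp]: "peval (f + g) Y = peval f Y + peval g Y"
proof -
  let ?K = "Poly_Mapping.keys f \<union> Poly_Mapping.keys g"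
  have "Poly_Mapping.keys (f + g) \<subseteq> ?K" by (rule Poly_Mapping.keys_add)
  then show ?thesis
    by (subst (1 2 3) peval_superset[of ?K])
       (auto simp: lookup_add algebra_simps sum.distrib)
qed

lemma peval_sum: "peval (sum f A) Y = (\<Sum>a\<in>A. peval (f a) Y)"
  by (induction A rule: infinite_finite_induct) auto

lemma poly_mapping_sum_singles:
  "f = (\<Sum>m\<in>Poly_Mapping.keys f. Poly_Mapping.single m (Poly_Mapping.lookup f m))"
  by (rule poly_mapping_eqI)
     (auto simp: lookup_sum lookup_single when_def in_keys_iff)

lemma peval_mult [simp]: "peval (f * g) Y = peval f Y * peval g Y"
proof -
  have "f * g = (\<Sum>m\<in>Poly_Mapping.keys f. \<Sum>l\<in>Poly_Mapping.keys g.
      Poly_Mapping.single (m + l) (Poly_Mapping.lookup f m * Poly_Mapping.lookup g l))"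
    by (subst poly_mapping_sum_singles[of f], subst poly_mapping_sum_singles[of g])
       (simp add: sum_product mult_single)
  then show ?thesis
    by (simp add: peval_sum peval_single)
       (simp add: peval_def sum_product lookup_add power_add prod.distrib mult_ac)
qed

text \<open>The functions of \<open>x\<close> that are polynomials in the coordinates of \<open>phi x\<close> form a ring. The
  fundamental theorem on symmetric polynomials is replaced by membership in this ring, which
  is shown for the power sums of the cosines and then for the square of the Jacobian.\<close>

definition phi_poly :: "(real^'n::{finite,wellorder} \<Rightarrow> real) \<Rightarrow> bool" where
  "phi_poly g \<longleftrightarrow> (\<exists>p. \<forall>x. g x = peval p (phi x))"

lemma phi_poly_const: "phi_poly (\<lambda>x. a)"
  unfolding phi_poly_def
  by (rule exI[of _ "Poly_Mapping.single 0 a"]) (simp add: peval_single)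

lemma phi_poly_X: "phi_poly (\<lambda>x::real^'n::{finite,wellorder}. X j x)"
proof -
  have "(\<Prod>i\<in>UNIV. (phi x $ i) ^ (if j = i then Suc 0 else 0)) = X j x" for x :: "real^'n::_"
  proof -
    have "(\<Prod>i\<in>UNIV. (phi x $ i) ^ (if j = i then Suc 0 else 0))
        = (\<Prod>i\<in>UNIV. if j = i then phi x $ i else 1)"
      by (rule prod.cong) auto
    then show ?thesis by (simp add: phi_def)
  qed
  then show ?thesis
    unfolding phi_poly_def
    by (intro exI[of _ "Poly_Mapping.single (Poly_Mapping.single j 1) 1"])
       (simp add: peval_single lookup_single when_def)
qed

lemma phi_poly_add: "phi_poly f \<Longrightarrow> phi_poly g \<Longrightarrow> phi_poly (\<lambda>x. f x + g x)"
  unfolding phi_poly_def by (metis peval_add)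

lemma phi_poly_mult: "phi_poly f \<Longrightarrow> phi_poly g \<Longrightarrow> phi_poly (\<lambda>x. f x * g x)"
  unfolding phi_poly_def by (metis peval_mult)

lemma phi_poly_cmult: "phi_poly g \<Longrightarrow> phi_poly (\<lambda>x. a * g x)"
  by (rule phi_poly_mult[OF phi_poly_const])

lemma phi_poly_diff: "phi_poly f \<Longrightarrow> phi_poly g \<Longrightarrow> phi_poly (\<lambda>x. f x - g x)"
  using phi_poly_add[OF _ phi_poly_cmult[of g "-1"]] by simp

lemma phi_poly_sum: "(\<And>i. i \<in> A \<Longrightarrow> phi_poly (f i)) \<Longrightarrow> phi_poly (\<lambda>x. \<Sum>i\<in>A. f i x)"
  by (induction A rule: infinite_finite_induct) (auto intro: phi_poly_const phi_poly_add)

lemma phi_poly_prod: "(\<And>i. i \<in> A \<Longrightarrow> phi_poly (f i)) \<Longrightarrow> phi_poly (\<lambda>x. \<Prod>i\<in>A. f i x)"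
  by (induction A rule: infinite_finite_induct) (auto intro: phi_poly_const phi_poly_mult)

lemma phi_poly_det:
  assumes "\<And>i j. phi_poly (\<lambda>x. M x $ i $ j)"
  shows "phi_poly (\<lambda>x. det (M x :: real^'m^'m))"
  unfolding det_def
  by (intro phi_poly_sum phi_poly_cmult phi_poly_prod assms)

section \<open>The product of linear factors\<close>

text \<open>The coefficients of this polynomial are the elementary symmetric functions of the
  values of \<open>u\<close> on \<open>A\<close>, in reverse order.\<close>

definition linprod :: "('i \<Rightarrow> real) \<Rightarrow> 'i set \<Rightarrow> real poly" where
  "linprod u A = (\<Prod>i\<in>A. [:u i, 1:])"

lemma coeff_linear_mult:
  "coeff ([:a, 1:] * p) m = (a::real) * coeff p m + (if m = 0 then 0 else coeff p (m - 1))"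
  by (cases m) auto

lemma linprod_remove:
  "finite A \<Longrightarrow> i \<in> A \<Longrightarrow> linprod u A = [:u i, 1:] * linprod u (A - {i})"
  unfolding linprod_def by (rule prod.remove)

lemma linprod_insert:
  "finite A \<Longrightarrow> i \<notin> A \<Longrightarrow> linprod u (insert i A) = [:u i, 1:] * linprod u A"
  unfolding linprod_def by (rule prod.insert)

lemma coeff_linprod_remove:
  assumes "finite A" "i \<in> A"
  shows "coeff (linprod u A) m
    = u i * coeff (linprod u (A - {i})) m + (if m = 0 then 0 else coeff (linprod u (A - {i})) (m - 1))"
  using assms by (simp only: linprod_remove coeff_linear_mult)

lemma
  assumes "finite A"
  shows coeff_linprod_card: "coeff (linprod u A) (card A) = 1"
    and degree_linprod: "degree (linprod u A) = card A"
proof -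
  have "coeff (linprod u A) (card A) = 1 \<and> degree (linprod u A) = card A"
    using assms
  proof (induction A rule: finite_induct)
    case (insert a A)
    have "degree (linprod u (insert a A)) = Suc (card A)"
      using insert unfolding linprod_insert[OF insert(1,2)]
      by (subst degree_mult_eq) auto
    moreover have "coeff (linprod u A) (Suc (card A)) = 0"
      using insert by (intro coeff_eq_0) auto
    ultimately show ?case using insert
      by (simp add: linprod_insert del: mult_pCons_left) (simp add: coeff_linear_mult del: mult_pCons_left)
  qed (simp add: linprod_def)
  then show "coeff (linprod u A) (card A) = 1" "degree (linprod u A) = card A" by simp_all
qed

lemma poly_linprod: "poly (linprod u A) z = (\<Prod>i\<in>A. u i + z)"
  by (simp add: linprod_def poly_prod)

lemma coeff_linprod:
  assumes "finite A"
  shows "coeff (linprod u A) m = (\<Sum>B | B \<subseteq> A \<and> card (A - B) = m. \<Prod>i\<in>B. u i)"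
proof -
  have c: "(\<Prod>i\<in>B. [:u i:]) = [:\<Prod>i\<in>B. u i:]" for B
    by (induction B rule: infinite_finite_induct) auto
  have "linprod u A = (\<Prod>i\<in>A. [:u i:] + [:0, 1:])"
    by (simp add: linprod_def)
  also have "\<dots> = (\<Sum>B\<in>Pow A. (\<Prod>i\<in>B. [:u i:]) * (\<Prod>i\<in>A - B. [:0, 1:]))"
    by (rule prod_add[OF assms])
  also have "\<dots> = (\<Sum>B\<in>Pow A. monom (\<Prod>i\<in>B. u i) (card (A - B)))"
    by (simp only: c prod_constant) (simp add: monom_altdef)
  finally have "coeff (linprod u A) m
      = (\<Sum>B\<in>Pow A. if card (A - B) = m then (\<Prod>i\<in>B. u i) else 0)"
    by (simp add: coeff_sum)
  also have "\<dots> = (\<Sum>B | B \<subseteq> A \<and> card (A - B) = m. \<Prod>i\<in>B. u i)"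
    using assms by (subst sum.inter_filter[symmetric]) (auto intro!: sum.cong)
  finally show ?thesis .
qed

text \<open>The power of the variable in \<open>linprod u UNIV\<close> at which the elementary symmetric function with
  the same number of factors as \<open>{..j}\<close> has elements stands as coefficient. It enumerates
  \<open>0, \<dots>, n - 1\<close> and so turns sums over the index type into sums over exponents.\<close>

definition above :: "'n::{finite,wellorder} \<Rightarrow> nat" where
  "above j = card {j<..}"

lemma above_strict: "i < j \<Longrightarrow> above j < above i"
  unfolding above_def by (intro psubset_card_mono) auto

lemma inj_above: "inj above"
  by (intro injI) (metis above_strict less_irrefl linorder_neqE)

lemma bij_betw_above: "bij_betw above (UNIV :: 'n::{finite,wellorder} set) {..<CARD('n)}"
proof -
  have "above (j::'n) < CARD('n)" for j
    unfolding above_def by (intro psubset_card_mono) auto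
  then have "above ` (UNIV::'n set) \<subseteq> {..<CARD('n)}" by auto
  then have "above ` (UNIV::'n set) = {..<CARD('n)}"
    by (intro card_subset_eq) (auto simp: card_image[OF inj_above])
  then show ?thesis by (simp add: bij_betw_def inj_above)
qed

text \<open>The orbit of \<open>(1,\<dots>,1,0,\<dots>,0)\<close> is counted with multiplicity in \<open>X j\<close>; the multiplicity is
  the order of its stabilizer.\<close>

definition kappa :: "'n::{finite,wellorder} \<Rightarrow> real" where
  "kappa j = real (card {\<sigma>. \<sigma> permutes (UNIV::'n set) \<and> \<sigma> -` {..j} = {..j}})"

lemma kappa_pos: "kappa j > 0"
proof -
  let ?S = "{\<sigma>. \<sigma> permutes (UNIV::'a set) \<and> \<sigma> -` {..j} = {..j}}"
  have "id \<in> ?S" by (simp add: permutes_id)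
  then have "?S \<noteq> {}" by blast
  moreover have "finite ?S"
    by (rule finite_subset[OF _ finite_permutations[of UNIV]]) auto
  ultimately have "card ?S > 0" by (intro card_gt_0_iff[THEN iffD2] conjI)
  then show ?thesis unfolding kappa_def by linarith
qed

abbreviation cosprod :: "real^'n::{finite,wellorder} \<Rightarrow> 'n set \<Rightarrow> real poly" where
  "cosprod x \<equiv> linprod (\<lambda>i. cos (pi * x $ i))"

text \<open>In \<open>X j\<close> a permutation \<open>\<sigma>\<close> contributes the product of the cosines over \<open>\<sigma> -` {..j}\<close>. Every set
  with as many elements as \<open>{..j}\<close> occurs equally often, by translation with a permutation
  that maps it onto \<open>{..j}\<close>; hence \<open>X j\<close> is a multiple of an elementary symmetric function.\<close>

lemma X_conv_coeff:
  fixes x :: "real^'n::{finite,wellorder}"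
  shows "X j x = kappa j * coeff (cosprod x UNIV) (above j)"
proof -
  define u where "u = (\<lambda>i. cos (pi * x $ i))"
  let ?P = "{\<sigma>. \<sigma> permutes (UNIV::'n set)}"
  let ?T = "{B::'n set. card (UNIV - B) = above j}"
  have fin: "finite ?P" by (simp add: finite_permutations)
  have compl: "UNIV - {..j} = {j<..}" by auto
  have "X j x = (\<Sum>\<sigma>\<in>?P. \<Prod>i\<in>UNIV. if i \<in> \<sigma> -` {..j} then u i else 1)"
    unfolding X_def cos_plus_def u_def by (intro sum.cong prod.cong) auto
  also have "\<dots> = (\<Sum>\<sigma>\<in>?P. \<Prod>i\<in>\<sigma> -` {..j}. u i)"
    by (simp add: prod.If_cases vimage_def)
  also have "\<dots> = (\<Sum>B\<in>?T. \<Sum>\<sigma> | \<sigma> \<in> ?P \<and> \<sigma> -` {..j} = B. \<Prod>i\<in>\<sigma> -` {..j}. u i)"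
  proof (rule sum.group[symmetric, OF fin])
    show "(\<lambda>\<sigma>. \<sigma> -` {..j}) ` ?P \<subseteq> ?T"
    proof clarify
      fix \<sigma> :: "'n \<Rightarrow> 'n" assume s: "\<sigma> permutes UNIV"
      have "UNIV - \<sigma> -` {..j} = \<sigma> -` {j<..}" by auto
      then show "card (UNIV - \<sigma> -` {..j}) = above j"
        unfolding above_def
        using card_vimage_inj[OF permutes_inj[OF s], of "{j<..}"] permutes_surj[OF s] by simp
    qed
  qed simp
  also have "\<dots> = (\<Sum>B\<in>?T. kappa j * (\<Prod>i\<in>B. u i))"
  proof (rule sum.cong[OF refl])
    fix B assume B: "B \<in> ?T"
    have "card {..j} = card B"
      using B compl card_Diff_subset[of "{..j}" UNIV] card_Diff_subset[of B UNIV]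
        card_mono[of UNIV "{..j}"] card_mono[of UNIV B]
      unfolding above_def by (auto simp: finite_subset)
    moreover from this have "card (UNIV - B) = card (UNIV - {..j})"
      using B compl by (simp add: above_def)
    ultimately obtain f g where f: "bij_betw f B {..j}" and g: "bij_betw g (UNIV - B) (UNIV - {..j})"
      by (metis bij_betw_iff_card finite_code)
    define \<tau> where "\<tau> = (\<lambda>i. if i \<in> B then f i else g i)"
    have "bij_betw \<tau> (B \<union> (UNIV - B)) ({..j} \<union> (UNIV - {..j}))"
    proof (rule bij_betw_combine)
      show "bij_betw \<tau> B {..j}"
        using f by (subst bij_betw_cong[of B \<tau> f]) (auto simp: \<tau>_def)
      show "bij_betw \<tau> (UNIV - B) (UNIV - {..j})"
        using g by (subst bij_betw_cong[of _ \<tau> g]) (auto simp: \<tau>_def)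
    qed auto
    then have bij: "bij \<tau>" by simp
    then have \<tau>: "\<tau> permutes UNIV" by (simp add: permutes_def bij_iff)
    have vB: "\<tau> -` {..j} = B"
    proof (rule set_eqI)
      fix i show "i \<in> \<tau> -` {..j} \<longleftrightarrow> i \<in> B"
        using bij_betwE[OF f] bij_betwE[OF g] by (cases "i \<in> B") (simp_all add: \<tau>_def)
    qed
    have "{\<sigma>. \<sigma> \<in> ?P \<and> \<sigma> -` {..j} = B}
        = (\<lambda>\<sigma>. \<sigma> \<circ> \<tau>) ` {\<sigma>. \<sigma> permutes UNIV \<and> \<sigma> -` {..j} = {..j}}" (is "?L = ?R")
    proof (intro equalityI subsetI)
      fix \<sigma> assume s: "\<sigma> \<in> ?L"
      have "(\<sigma> \<circ> inv \<tau>) -` {..j} = inv \<tau> -` (\<tau> -` {..j})"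
        using s vB by (auto simp: vimage_comp)
      also have "\<dots> = {..j}"
        by (simp add: vimage_comp permutes_inv_o[OF \<tau>])
      finally have "\<sigma> \<circ> inv \<tau> \<in> {\<sigma>. \<sigma> permutes UNIV \<and> \<sigma> -` {..j} = {..j}}"
        using s \<tau> by (auto intro: permutes_compose permutes_inv)
      moreover have "\<sigma> = (\<sigma> \<circ> inv \<tau>) \<circ> \<tau>"
        by (simp add: o_assoc[symmetric] permutes_inv_o[OF \<tau>])
      ultimately show "\<sigma> \<in> ?R" by blast
    next
      fix \<sigma> assume "\<sigma> \<in> ?R"
      then obtain \<rho> where r: "\<rho> permutes UNIV" "\<rho> -` {..j} = {..j}" "\<sigma> = \<rho> \<circ> \<tau>" by auto
      then show "\<sigma> \<in> ?L"
        using vB permutes_compose[OF \<tau> r(1)] by (simp add: vimage_comp[symmetric])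
    qed
    moreover have "inj_on (\<lambda>\<sigma>. \<sigma> \<circ> \<tau>) S" for S :: "('n \<Rightarrow> 'n) set"
      using permutes_surj[OF \<tau>] by (auto intro!: inj_onI simp: fun.inj_map surj_fun_eq)
    ultimately have "real (card {\<sigma>. \<sigma> \<in> ?P \<and> \<sigma> -` {..j} = B}) = kappa j"
      unfolding kappa_def by (simp add: card_image)
    then show "(\<Sum>\<sigma> | \<sigma> \<in> ?P \<and> \<sigma> -` {..j} = B. \<Prod>i\<in>\<sigma> -` {..j}. u i) = kappa j * (\<Prod>i\<in>B. u i)"
      by simp
  qed
  also have "\<dots> = kappa j * coeff (linprod u UNIV) (above j)"
    by (simp add: coeff_linprod sum_distrib_left)
  finally show ?thesis by (simp add: u_def)
qed

section \<open>Sorting and injectivity\<close>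

definition perm :: "('n \<Rightarrow> 'n) \<Rightarrow> 'a^'n \<Rightarrow> 'a^'n" where
  "perm \<sigma> x = (\<chi> i. x $ \<sigma> i)"

lemma perm_nth [simp]: "perm \<sigma> x $ i = x $ \<sigma> i"
  by (simp add: perm_def)

lemma perm_perm: "perm \<sigma> (perm \<tau> x) = perm (\<tau> \<circ> \<sigma>) x"
  by (simp add: vec_eq_iff)

lemma perm_inverse:
  assumes "\<sigma> permutes UNIV"
  shows "perm (inv \<sigma>) (perm \<sigma> x) = x" "perm \<sigma> (perm (inv \<sigma>) x) = x"
  using permutes_inverses[OF assms] by (simp_all add: vec_eq_iff)

lemma fund_domD:
  assumes "x \<in> fund_dom"
  shows "0 \<le> x $ i" "x $ i \<le> 1" "i \<le> j \<Longrightarrow> x $ j \<le> x $ i"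
  using assms unfolding fund_dom_def by blast+

lemma phi_perm:
  assumes "\<sigma> permutes UNIV"
  shows "phi (perm \<sigma> x) = phi x"
proof -
  have "cosprod (perm \<sigma> x) UNIV = cosprod x UNIV"
    unfolding linprod_def perm_nth
    by (rule prod.permute[OF assms, symmetric, unfolded o_def])
  then show ?thesis by (simp add: phi_def vec_eq_iff X_conv_coeff)
qed

text \<open>The sets \<open>{i. a \<le> x $ i}\<close> of a decreasing vector are initial segments, hence determined
  by their cardinality, which is invariant under permutations.\<close>

lemma sorted_perm_unique:
  fixes x :: "real^'n::{finite,wellorder}"
  assumes \<sigma>: "\<sigma> permutes UNIV"
    and x: "\<And>i j. i \<le> j \<Longrightarrow> x $ j \<le> x $ i"
    and y: "\<And>i j. i \<le> j \<Longrightarrow> perm \<sigma> x $ j \<le> perm \<sigma> x $ i"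
  shows "perm \<sigma> x = x"
proof -
  let ?y = "perm \<sigma> x"
  have eq: "{i. a \<le> ?y $ i} = {i. a \<le> x $ i}" (is "?A = ?B") for a
  proof -
    have "?A = \<sigma> -` ?B" by auto
    then have card: "card ?A = card ?B"
      using card_vimage_inj[OF permutes_inj[OF \<sigma>], of ?B] permutes_surj[OF \<sigma>] by simp
    have "?A \<subseteq> ?B \<or> ?B \<subseteq> ?A"
    proof (rule ccontr)
      assume "\<not> ?thesis"
      then obtain i j where ij: "i \<in> ?A" "i \<notin> ?B" "j \<in> ?B" "j \<notin> ?A" by auto
      then have "\<not> i \<le> j" using x[of i j] by auto
      moreover have "\<not> j \<le> i" using ij y[of j i] by auto
      ultimately show False by auto
    qed
    with card show ?thesis
      by (metis card_subset_eq finite_code)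
  qed
  have "?y $ i = x $ i" for i
    using eq[of "?y $ i"] eq[of "x $ i"] by (intro antisym) auto
  then show ?thesis by (simp add: vec_eq_iff)
qed

text \<open>A permutation that maximizes the correlation with a strictly decreasing
  vector sorts: otherwise a transposition would increase the correlation.\<close>

lemma sorting_perm_exists:
  fixes x :: "real^'n::{finite,wellorder}"
  obtains \<sigma> where "\<sigma> permutes UNIV" "\<And>i j. i \<le> j \<Longrightarrow> perm \<sigma> x $ j \<le> perm \<sigma> x $ i"
proof -
  let ?P = "{\<sigma>. \<sigma> permutes (UNIV::'n set)}"
  define g where "g = (\<lambda>\<sigma>::'n \<Rightarrow> 'n. \<Sum>i\<in>UNIV. real (above i) * x $ \<sigma> i)"
  have "finite ?P" "?P \<noteq> {}"
    by (auto simp: finite_permutations intro: permutes_id)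
  then have fin: "finite (g ` ?P)" and "Max (g ` ?P) \<in> g ` ?P" by (auto intro!: Max_in)
  then obtain \<sigma> where \<sigma>: "\<sigma> \<in> ?P" and "Max (g ` ?P) = g \<sigma>" by (elim imageE)
  then have max: "g \<tau> \<le> g \<sigma>" if "\<tau> \<in> ?P" for \<tau>
    using Max_ge[OF fin imageI[OF that]] by simp
  have "x $ \<sigma> j \<le> x $ \<sigma> i" if "i \<le> j" for i j
  proof (rule ccontr)
    assume less: "\<not> x $ \<sigma> j \<le> x $ \<sigma> i"
    then have ij: "i < j" using that by (cases "i = j") auto
    let ?t = "Transposition.transpose i j"
    have t: "?t permutes UNIV" by (rule permutes_swap_id) auto
    have split: "(\<Sum>k\<in>UNIV. f k) = f i + f j + (\<Sum>k\<in>UNIV - {i, j}. f k)" for f :: "'n \<Rightarrow> real"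
      using ij by (subst sum.subset_diff[of "{i, j}"]) auto
    have "(\<Sum>k\<in>UNIV - {i, j}. real (above k) * x $ \<sigma> (?t k))
        = (\<Sum>k\<in>UNIV - {i, j}. real (above k) * x $ \<sigma> k)"
      by (intro sum.cong) (auto simp: transpose_def)
    then have "g (\<sigma> \<circ> ?t) - g \<sigma> = (real (above i) - real (above j)) * (x $ \<sigma> j - x $ \<sigma> i)"
      unfolding g_def split[of "\<lambda>k. real (above k) * x $ (\<sigma> \<circ> ?t) k"]
        split[of "\<lambda>k. real (above k) * x $ \<sigma> k"]
      by (simp add: algebra_simps)
    moreover have "\<dots> > 0"
      using less above_strict[OF ij] by (intro mult_pos_pos) auto
    moreover have "g (\<sigma> \<circ> ?t) \<le> g \<sigma>"
      using \<sigma> t by (intro max) (auto intro: permutes_compose)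
    ultimately show False by simp
  qed
  with \<sigma> show ?thesis by (intro that[of \<sigma>]) auto
qed

lemma cos_pi_inj: "cos (pi * a) = cos (pi * b) \<Longrightarrow> 0 \<le> a \<Longrightarrow> a \<le> 1 \<Longrightarrow> 0 \<le> b \<Longrightarrow> b \<le> 1 \<Longrightarrow> a = b"
  using cos_inj_pi[of "pi * a" "pi * b"] by (simp add: mult_le_cancel_left1)

text \<open>The characters give all coefficients below the leading one, since the constants \<open>kappa j\<close> do
  not vanish; the leading coefficient is 1.\<close>

lemma cosprod_determined:
  assumes "phi x = phi y"
  shows "cosprod x UNIV = cosprod (y::real^'n::{finite,wellorder}) UNIV"
proof (rule poly_eqI)
  fix m
  consider "m < CARD('n)" | "m = CARD('n)" | "m > CARD('n)" by linarith
  then show "coeff (cosprod x UNIV) m = coeff (cosprod y UNIV) m"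
  proof cases
    case 1
    then obtain j :: 'n where m: "m = above j"
      using bij_betw_above by (metis bij_betw_imp_surj_on imageE lessThan_iff)
    have "X j x = X j y" using assms by (simp add: phi_def vec_eq_iff)
    then show ?thesis using kappa_pos[of j] by (simp add: m X_conv_coeff)
  next
    case 2
    then show ?thesis by (simp add: coeff_linprod_card)
  next
    case 3
    then have "coeff (cosprod z UNIV) m = 0" for z :: "real^'n::_"
      by (intro coeff_eq_0) (simp add: degree_linprod)
    then show ?thesis by simp
  qed
qed

text \<open>The polynomial \<open>\<Prod>i. z + cos (pi * x $ i)\<close> determines the multiset of its roots, and on
  \<open>[0, 1]\<close> the cosine determines the coordinate.\<close>

lemma inj_on_phi: "inj_on phi (fund_dom :: (real^'n::{finite,wellorder}) set)"
proof (rule inj_onI)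
  fix x y :: "real^'n::{finite,wellorder}"
  assume x: "x \<in> fund_dom" and y: "y \<in> fund_dom" and "phi x = phi y"
  then have "cosprod x UNIV = cosprod y UNIV" by (intro cosprod_determined)
  moreover have "proots (cosprod z UNIV) = (\<Sum>i\<in>UNIV. {#- cos (pi * z $ i)#})" for z :: "real^'n::_"
    unfolding linprod_def by (subst proots_prod) auto
  ultimately have "(\<Sum>i\<in>UNIV. {#- cos (pi * x $ i)#}) = (\<Sum>i\<in>UNIV. {#- cos (pi * y $ i)#})"
    by metis
  then have m: "image_mset (\<lambda>i. - cos (pi * y $ i)) (mset_set UNIV)
      = image_mset (\<lambda>i. - cos (pi * x $ i)) (mset_set UNIV)"
    by (simp add: sum_unfold_sum_mset)
  obtain \<sigma> where \<sigma>1: "\<sigma> permutes UNIV"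
    and "\<forall>i\<in>UNIV. - cos (pi * y $ i) = - cos (pi * x $ \<sigma> i)"
    by (rule image_mset_eq_implies_permutes[OF _ m]) auto
  then have \<sigma>2: "cos (pi * y $ i) = cos (pi * x $ \<sigma> i)" for i by simp
  have "y $ i = x $ \<sigma> i" for i
    by (rule cos_pi_inj[OF \<sigma>2]) (intro fund_domD x y)+
  then have y_eq: "y = perm \<sigma> x" by (simp add: vec_eq_iff)
  have "perm \<sigma> x = x"
    by (rule sorted_perm_unique[OF \<sigma>1]) (use fund_domD(3)[OF x] fund_domD(3)[OF y] y_eq in blast)+
  then show "x = y" using y_eq by simp
qed

section \<open>The Jacobian of the fundamental characters\<close>

text \<open>The product rule, read off coefficientwise: each factor is linear with leading coefficient 1,
  so differentiating the factor of \<open>i\<close> leaves the product over the other indices.\<close>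

lemma coeff_linprod_has_derivative:
  assumes "finite A" "\<And>i. i \<in> A \<Longrightarrow> (u i has_derivative u' i) (at x within S)"
  shows "((\<lambda>x. coeff (linprod (\<lambda>i. u i x) A) m) has_derivative
    (\<lambda>h. \<Sum>i\<in>A. u' i h * coeff (linprod (\<lambda>i. u i x) (A - {i})) m)) (at x within S)"
  using assms
proof (induction A arbitrary: m rule: finite_induct)
  case empty
  then show ?case by (simp add: linprod_def)
next
  case (insert a A)
  let ?L = "\<lambda>A x. linprod (\<lambda>i. u i x) A"
  let ?d = "\<lambda>m h. \<Sum>i\<in>A. u' i h * coeff (?L (A - {i}) x) m"
  have IH: "((\<lambda>x. coeff (?L A x) m) has_derivative ?d m) (at x within S)" for m
    using insert by simp
  have ua: "(u a has_derivative u' a) (at x within S)" using insert by simp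
  have eq: "coeff (?L (insert a A) y) m
      = u a y * coeff (?L A y) m + (if m = 0 then 0 else coeff (?L A y) (m - 1))" for y
    unfolding linprod_insert[OF insert(1,2)] coeff_linear_mult ..
  have "coeff (?L (insert a A - {i}) x) m
      = u a x * coeff (?L (A - {i}) x) m + (if m = 0 then 0 else coeff (?L (A - {i}) x) (m - 1))"
    if "i \<in> A" for i
  proof -
    have "insert a A - {i} = insert a (A - {i})" using that insert(2) by auto
    moreover have "linprod v (insert a (A - {i})) = [:v a, 1:] * linprod v (A - {i})" for v
      using insert(1,2) by (intro linprod_insert) auto
    ultimately show ?thesis by (simp only: coeff_linear_mult)
  qed
  then have "(\<Sum>i\<in>A. u' i h * coeff (?L (insert a A - {i}) x) m)
     = (\<Sum>i\<in>A. u' i h * (u a x * coeff (?L (A - {i}) x) m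
         + (if m = 0 then 0 else coeff (?L (A - {i}) x) (m - 1))))" for h
    by (intro sum.cong) auto
  moreover have "(\<Sum>i\<in>A. u' i h * (u a x * coeff (?L (A - {i}) x) m
         + (if m = 0 then 0 else coeff (?L (A - {i}) x) (m - 1))))
       = u a x * ?d m h + (if m = 0 then 0 else ?d (m - 1) h)" for h
    by (cases "m = 0") (simp_all add: algebra_simps sum.distrib sum_distrib_left)
  moreover have "insert a A - {a} = A" using insert(2) by auto
  ultimately have rhs: "(\<Sum>i\<in>insert a A. u' i h * coeff (?L (insert a A - {i}) x) m)
      = u a x * ?d m h + u' a h * coeff (?L A x) m + (if m = 0 then 0 else ?d (m - 1) h)" for h
    using insert(1,2) by simp
  show ?case unfolding eq rhs
    by (cases "m = 0")
       (use has_derivative_mult[OF ua IH[of m]] has_derivative_add[OF has_derivative_mult[OF ua IH[of m]] IH[of "m - 1"]] in simp_all)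
qed

definition dphi :: "real^'n::{finite,wellorder} \<Rightarrow> real^'n::_^'n::_" where
  "dphi x = (\<chi> j i. kappa j * (- pi * sin (pi * x $ i) * coeff (cosprod x (UNIV - {i})) (above j)))"

lemma phi_has_derivative:
  fixes x :: "real^'n::{finite,wellorder}"
  shows "(phi has_derivative (\<lambda>h. dphi x *v h)) (at x within S)"
proof (subst has_derivative_componentwise_within, intro ballI)
  fix b :: "real^'n::_" assume "b \<in> Basis"
  then obtain j where b: "b = axis j 1" by (auto simp: Basis_vec_def)
  have u: "((\<lambda>x::real^'n::_. cos (pi * x $ i)) has_derivative (\<lambda>h. - sin (pi * x $ i) * (pi * h $ i))) (at x within S)" for i
    by (auto intro!: derivative_eq_intros bounded_linear_imp_has_derivative[OF bounded_linear_vec_nth])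
  have "((\<lambda>x. X j x) has_derivative (\<lambda>h. kappa j * (\<Sum>i\<in>UNIV. (- sin (pi * x $ i) * (pi * h $ i))
      * coeff (cosprod x (UNIV - {i})) (above j)))) (at x within S)"
    unfolding X_conv_coeff
    by (intro has_derivative_mult_right coeff_linprod_has_derivative u) simp
  moreover have "(\<lambda>h. kappa j * (\<Sum>i\<in>UNIV. (- sin (pi * x $ i) * (pi * h $ i))
      * coeff (cosprod x (UNIV - {i})) (above j))) = (\<lambda>h. (dphi x *v h) $ j)"
    by (auto simp: dphi_def matrix_vector_mult_def sum_distrib_left fun_eq_iff intro!: sum.cong)
  ultimately show "((\<lambda>x. phi x \<bullet> b) has_derivative (\<lambda>h. (dphi x *v h) \<bullet> b)) (at x within S)"
    by (simp add: b phi_def inner_axis)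
qed

lemma J_conv_dphi: "J x = det (dphi x)"
proof -
  have "frechet_derivative phi (at x) = (\<lambda>h. dphi x *v h)"
    using frechet_derivative_at[OF phi_has_derivative] by metis
  then show ?thesis by (simp add: J_def jacobian_def)
qed

text \<open>Let \<open>Q i\<close> be the product of the factors other than the \<open>i\<close>-th. Evaluation of \<open>Q i\<close> at
  \<open>- cos (pi * x $ k)\<close> gives \<open>0\<close> unless \<open>i = k\<close>; so the Jacobian matrix times a Vandermonde matrix is
  diagonal.\<close>

lemma J_nonzero:
  fixes x :: "real^'n::{finite,wellorder}"
  assumes x: "\<And>i. 0 < x $ i" "\<And>i. x $ i < 1" and distinct: "\<And>i j. i \<noteq> j \<Longrightarrow> x $ i \<noteq> x $ j"
  shows "J x \<noteq> 0"
proof -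
  define u where "u = (\<lambda>i. cos (pi * x $ i))"
  define W :: "real^'n::_^'n::_" where "W = (\<chi> j k. (- u k) ^ above j / kappa j)"
  define s where "s = (\<lambda>i. - pi * sin (pi * x $ i))"
  have kappa: "kappa j \<noteq> 0" for j :: 'n
    using kappa_pos[of j] by simp
  have entry: "(transpose (dphi x) ** W) $ i $ k = s i * (\<Prod>l\<in>UNIV - {i}. u l - u k)" for i k
  proof -
    let ?q = "linprod u (UNIV - {i})"
    have deg: "degree ?q < CARD('n)"
      by (subst degree_linprod) (auto intro: card_Diff1_less)
    have "(transpose (dphi x) ** W) $ i $ k = (\<Sum>j\<in>(UNIV::'n set). s i * (coeff ?q (above j) * (- u k) ^ above j))"
      by (auto simp: kappa mult.assoc matrix_matrix_mult_def transpose_def dphi_def W_def s_def u_def intro!: sum.cong)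
    also have "\<dots> = s i * (\<Sum>m<CARD('n). coeff ?q m * (- u k) ^ m)"
      unfolding sum_distrib_left[symmetric]
      by (subst sum.reindex_bij_betw[OF bij_betw_above, symmetric]) simp
    also have "(\<Sum>m<CARD('n). coeff ?q m * (- u k) ^ m) = poly ?q (- u k)"
      unfolding poly_altdef
      by (rule sum.mono_neutral_right) (use deg in \<open>auto intro: coeff_eq_0\<close>)
    also have "\<dots> = (\<Prod>l\<in>UNIV - {i}. u l - u k)"
      by (simp add: poly_linprod)
    finally show ?thesis .
  qed
  have neq: "u l \<noteq> u k" if "l \<noteq> k" for l k
    using cos_pi_inj[of "x $ l" "x $ k"] x distinct[OF that] unfolding u_def
    by (meson less_imp_le)
  have "det (transpose (dphi x) ** W) = (\<Prod>i\<in>UNIV. (transpose (dphi x) ** W) $ i $ i)"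
    by (rule det_diagonal) (auto simp: entry prod_zero_iff)
  also have "\<dots> \<noteq> 0"
  proof -
    have "sin (pi * x $ i) \<noteq> 0" for i
      using sin_gt_zero[of "pi * x $ i"] x[of i] by simp
    then show ?thesis by (auto simp: entry s_def dest: neq)
  qed
  finally show ?thesis by (auto simp: J_conv_dphi det_mul)
qed

section \<open>The square of the Jacobian is a polynomial in the fundamental characters\<close>

lemma phi_poly_coeff: "phi_poly (\<lambda>x::real^'n::{finite,wellorder}. coeff (cosprod x UNIV) m)"
proof -
  consider "m < CARD('n)" | "m = CARD('n)" | "m > CARD('n)" by linarith
  then show ?thesis
  proof cases
    case 1
    then obtain j :: 'n where m: "m = above j"
      using bij_betw_above by (metis bij_betw_imp_surj_on imageE lessThan_iff)
    have "(\<lambda>x::real^'n::_. coeff (cosprod x UNIV) m) = (\<lambda>x. (1 / kappa j) * X j x)"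
      using kappa_pos[of j] by (simp add: m X_conv_coeff)
    then show ?thesis by (simp only: phi_poly_cmult phi_poly_X)
  next
    case 2
    then show ?thesis by (simp add: coeff_linprod_card phi_poly_const)
  next
    case 3
    then have "coeff (cosprod z UNIV) m = 0" for z :: "real^'n::_"
      by (intro coeff_eq_0) (simp add: degree_linprod)
    then show ?thesis by (simp add: phi_poly_const)
  qed
qed

lemma pderiv_linprod:
  "finite A \<Longrightarrow> pderiv (linprod u A) = (\<Sum>i\<in>A. linprod u (A - {i}))"
  unfolding linprod_def by (subst pderiv_prod) (simp add: pderiv_pCons)

text \<open>Newton's identities in disguise: the case \<open>k = 0\<close> is the formula for the derivative of
  the product, and the recursion of the coefficients raises \<open>k\<close>. The top coefficient of
  \<open>Q i\<close> being 1, the power sums are contained as a special case.\<close>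

lemma phi_poly_weighted_coeff:
  "phi_poly (\<lambda>x::real^'n::{finite,wellorder}.
     \<Sum>i\<in>UNIV. cos (pi * x $ i) ^ k * coeff (cosprod x (UNIV - {i})) m)"
proof (induction k arbitrary: m)
  case 0
  have "(\<Sum>i\<in>UNIV. coeff (cosprod x (UNIV - {i})) m)
      = real (Suc m) * coeff (cosprod x UNIV) (Suc m)" for x :: "real^'n::_"
    unfolding coeff_sum[symmetric] pderiv_linprod[OF finite, symmetric] by (simp add: coeff_pderiv)
  then show ?case by (simp add: phi_poly_cmult phi_poly_coeff del: of_nat_Suc)
next
  case (Suc k)
  let ?T = "\<lambda>m (x::real^'n::_). \<Sum>i\<in>UNIV. cos (pi * x $ i) ^ k * coeff (cosprod x (UNIV - {i})) m"
  have top: "coeff (cosprod x (UNIV - {i})) (CARD('n) - 1) = 1" for x :: "real^'n::_" and i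
    using coeff_linprod_card[of "UNIV - {i}" "\<lambda>i. cos (pi * x $ i)"] by (simp add: card_Diff_singleton)
  have eq: "(\<Sum>i\<in>UNIV. cos (pi * x $ i) ^ Suc k * coeff (cosprod x (UNIV - {i})) m)
      = coeff (cosprod x UNIV) m * ?T (CARD('n) - 1) x - (if m = 0 then 0 else ?T (m - 1) x)"
    for x :: "real^'n::_"
  proof -
    have "cos (pi * x $ i) ^ Suc k * coeff (cosprod x (UNIV - {i})) m
        = coeff (cosprod x UNIV) m * (cos (pi * x $ i) ^ k * coeff (cosprod x (UNIV - {i})) (CARD('n) - 1))
          - (if m = 0 then 0 else cos (pi * x $ i) ^ k * coeff (cosprod x (UNIV - {i})) (m - 1))" for i
      unfolding top by (simp add: coeff_linprod_remove[of UNIV i] algebra_simps)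
    then show ?thesis
      by (simp only: sum_subtractf sum_distrib_left[symmetric]) simp
  qed
  have "phi_poly (\<lambda>x. if m = 0 then 0 else ?T (m - 1) x)"
    using Suc.IH[of "m - 1"] by (cases "m = 0") (simp_all add: phi_poly_const)
  then show ?case unfolding eq
    by (intro phi_poly_diff phi_poly_mult phi_poly_coeff Suc.IH)
qed

text \<open>Families \<open>h x i\<close> whose sums over \<open>i\<close>, weighted by any power of the \<open>i\<close>-th cosine, are
  polynomials in the characters. Quantifying over all powers makes the class closed under
  multiplication by the cosine.\<close>

definition phi_power_sums :: "(real^'n::{finite,wellorder} \<Rightarrow> 'n \<Rightarrow> real) \<Rightarrow> bool" where
  "phi_power_sums h \<longleftrightarrow> (\<forall>k. phi_poly (\<lambda>x. \<Sum>i\<in>UNIV. cos (pi * x $ i) ^ k * h x i))"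

lemma phi_power_sums_one: "phi_power_sums (\<lambda>(x::real^'n::{finite,wellorder}) i. 1)"
proof -
  have "coeff (cosprod x (UNIV - {i})) (CARD('n) - 1) = 1" for x :: "real^'n::_" and i
    using coeff_linprod_card[of "UNIV - {i}" "\<lambda>i. cos (pi * x $ i)"] by (simp add: card_Diff_singleton)
  moreover have "phi_poly (\<lambda>x::real^'n::_. \<Sum>i\<in>UNIV. cos (pi * x $ i) ^ k
      * coeff (cosprod x (UNIV - {i})) (CARD('n) - 1))" for k
    by (rule phi_poly_weighted_coeff)
  ultimately show ?thesis by (simp add: phi_power_sums_def)
qed

lemma phi_power_sums_mult: "phi_poly g \<Longrightarrow> phi_power_sums h \<Longrightarrow> phi_power_sums (\<lambda>x i. g x * h x i)"
  unfolding phi_power_sums_def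
  using phi_poly_mult by (fastforce simp: sum_distrib_left mult.left_commute)

lemma phi_power_sums_diff: "phi_power_sums g \<Longrightarrow> phi_power_sums h \<Longrightarrow> phi_power_sums (\<lambda>x i. g x i - h x i)"
  unfolding phi_power_sums_def
  by (simp add: right_diff_distrib sum_subtractf phi_poly_diff)

lemma phi_power_sums_cos: "phi_power_sums h \<Longrightarrow> phi_power_sums (\<lambda>x i. cos (pi * x $ i) * h x i)"
  unfolding phi_power_sums_def
proof
  fix k assume "\<forall>k. phi_poly (\<lambda>x. \<Sum>i\<in>UNIV. cos (pi * x $ i) ^ k * h x i)"
  then have "phi_poly (\<lambda>x. \<Sum>i\<in>UNIV. cos (pi * x $ i) ^ Suc k * h x i)" by blast
  then show "phi_poly (\<lambda>x. \<Sum>i\<in>UNIV. cos (pi * x $ i) ^ k * (cos (pi * x $ i) * h x i))"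
    by (simp add: mult_ac)
qed

text \<open>The relation \<open>Q i * [:cos (pi * x $ i), 1:] = cosprod x UNIV\<close> expresses each coefficient of
  \<open>Q i\<close> through the next higher one, a coefficient of the full product and the \<open>i\<close>-th cosine;
  the recursion starts above the degree.\<close>

lemma phi_power_sums_coeff:
  assumes h: "phi_power_sums h"
  shows "phi_power_sums (\<lambda>(x::real^'n::{finite,wellorder}) i. coeff (cosprod x (UNIV - {i})) m * h x i)"
proof -
  have high: "coeff (cosprod x (UNIV - {i})) m = 0" if "m \<ge> CARD('n)" for x :: "real^'n::_" and i m
  proof (rule coeff_eq_0)
    have "degree (cosprod x (UNIV - {i})) < CARD('n)"
      by (subst degree_linprod) (auto intro: card_Diff1_less)
    with that show "degree (cosprod x (UNIV - {i})) < m" by simp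
  qed
  show ?thesis
  proof (cases "m \<ge> CARD('n)")
    case True
    then show ?thesis
      using phi_power_sums_mult[OF phi_poly_const[of 0] h] by (simp add: high)
  next
    case False
    then have "m \<le> CARD('n)" by simp
    then show ?thesis
    proof (induction m rule: inc_induct)
      case base
      then show ?case using phi_power_sums_mult[OF phi_poly_const[of 0] h] by (simp add: high)
    next
      case (step m)
      have "coeff (cosprod x (UNIV - {i})) m * h x i
          = coeff (cosprod x UNIV) (Suc m) * h x i
            - cos (pi * x $ i) * (coeff (cosprod x (UNIV - {i})) (Suc m) * h x i)" for x i
        by (simp add: coeff_linprod_remove[of UNIV i] algebra_simps)
      then show ?case
        by (simp only:) (intro phi_power_sums_diff phi_power_sums_mult phi_poly_coeff h phi_power_sums_cos step)
    qed
  qed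
qed

text \<open>With \<open>M\<close> the Jacobian matrix, the square of the determinant is the determinant of \<open>M\<close> times its
  transpose. The entries of that product are sums over \<open>i\<close>, in which the two sines combine to a
  polynomial in the cosine. Thus no discriminant has to be computed.\<close>

lemma phi_poly_J_square: "phi_poly (\<lambda>x::real^'n::{finite,wellorder}. (J x)\<^sup>2)"
proof -
  let ?q = "\<lambda>j (x::real^'n::_) i. coeff (cosprod x (UNIV - {i})) (above j)"
  have "phi_poly (\<lambda>x. (dphi x ** transpose (dphi x)) $ j $ k)" for j k :: 'n
  proof -
    have eq: "(dphi x ** transpose (dphi x)) $ j $ k
        = (kappa j * kappa k * pi\<^sup>2) * (\<Sum>i\<in>UNIV. cos (pi * x $ i) ^ 0 *
            (?q j x i * (?q k x i * (1 - cos (pi * x $ i) * (cos (pi * x $ i) * 1)))))" for x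
    proof -
      have "sin (pi * x $ i) * sin (pi * x $ i) = 1 - cos (pi * x $ i) * cos (pi * x $ i)" for i
        using sin_squared_eq[of "pi * x $ i"] by (simp add: power2_eq_square)
      then have "dphi x $ j $ i * dphi x $ k $ i = (kappa j * kappa k * pi\<^sup>2) *
          (?q j x i * (?q k x i * (1 - cos (pi * x $ i) * (cos (pi * x $ i) * 1))))" for i
        by (simp add: dphi_def power2_eq_square)
      then show ?thesis
        by (simp add: matrix_matrix_mult_def transpose_def sum_distrib_left)
    qed
    have "phi_power_sums (\<lambda>x i. ?q j x i * (?q k x i * (1 - cos (pi * x $ i) * (cos (pi * x $ i) * 1))))"
      by (intro phi_power_sums_coeff phi_power_sums_diff phi_power_sums_cos phi_power_sums_one)
    then show ?thesis
      unfolding eq phi_power_sums_def by (intro phi_poly_cmult) blast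
  qed
  then have "phi_poly (\<lambda>x::real^'n::_. det (dphi x ** transpose (dphi x)))"
    by (rule phi_poly_det)
  then show ?thesis by (simp add: J_conv_dphi det_mul det_transpose power2_eq_square)
qed

lemma calJ_phi:
  assumes "x \<in> fund_dom"
  shows "calJ (phi x) = \<bar>J x\<bar>"
proof -
  have "\<exists>p. \<forall>x\<in>fund_dom. (J (x::real^'a::_))\<^sup>2 = peval p (phi x)"
    using phi_poly_J_square unfolding phi_poly_def by blast
  from someI_ex[OF this] have "(J x)\<^sup>2 = peval pI (phi x)"
    using assms unfolding pI_def by blast
  then show ?thesis by (simp add: calJ_def flip: real_sqrt_abs)
qed

section \<open>Integration over the image of the fundamental domain\<close>

text \<open>The change of variables for vector-valued integrands, read for integrands in one dimension.\<close>

lemma has_absolute_integral_change_of_variables_to_real: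
  fixes f :: "real^'m::{finite,wellorder} \<Rightarrow> real" and g :: "real^'m::_ \<Rightarrow> real^'m::_"
  assumes S: "S \<in> sets lebesgue"
    and der: "\<And>x. x \<in> S \<Longrightarrow> (g has_derivative g' x) (at x within S)"
    and inj: "inj_on g S"
  shows "(\<lambda>x. \<bar>det (matrix (g' x))\<bar> * f (g x)) absolutely_integrable_on S \<and>
           integral S (\<lambda>x. \<bar>det (matrix (g' x))\<bar> * f (g x)) = b
     \<longleftrightarrow> f absolutely_integrable_on (g ` S) \<and> integral (g ` S) f = b"
proof -
  have "(\<lambda>x. \<bar>det (matrix (g' x))\<bar> *\<^sub>R vec (f (g x)) :: real^1) absolutely_integrable_on S \<and>
           integral S (\<lambda>x. \<bar>det (matrix (g' x))\<bar> *\<^sub>R vec (f (g x))) = (vec b :: real^1)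
         \<longleftrightarrow> (\<lambda>x. vec (f x) :: real^1) absolutely_integrable_on (g ` S) \<and>
           integral (g ` S) (\<lambda>x. vec (f x)) = (vec b :: real^1)"
    using assms by (intro has_absolute_integral_change_of_variables) auto
  then show ?thesis
    by (simp add: absolutely_integrable_on_1_iff integral_on_1_eq)
qed

text \<open>Up to the walls, the points of the fundamental domain have pairwise distinct coordinates
  strictly between 0 and 1.\<close>

definition walls :: "(real^'n::{finite,wellorder}) set" where
  "walls = (\<Union>i. {x. x $ i = 0}) \<union> (\<Union>i. {x. x $ i = 1}) \<union> (\<Union>(i, j)\<in>{(i, j). i \<noteq> j}. {x. x $ i = x $ j})"

lemma negligible_walls: "negligible (walls :: (real^'n::{finite,wellorder}) set)"
proof -
  have "negligible {x :: real^'n::_. x $ i = t}" for i t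
    using negligible_hyperplane[of "axis i 1 :: real^'n::_" t] by (simp add: inner_axis')
  moreover have "negligible {x :: real^'n::_. x $ i = x $ j}" if "i \<noteq> j" for i j
  proof -
    have "(axis i 1 - axis j 1 :: real^'n::_) \<noteq> 0"
      using that by (simp add: axis_eq_axis)
    then show ?thesis
      using negligible_hyperplane[of "axis i 1 - axis j 1 :: real^'n::_" 0] by (simp add: inner_diff_left inner_axis')
  qed
  ultimately show ?thesis
    unfolding walls_def by (intro negligible_Un negligible_Union) auto
qed

lemma not_walls:
  assumes "x \<notin> walls"
  shows "x $ i \<noteq> 0" "x $ i \<noteq> 1" "i \<noteq> j \<Longrightarrow> x $ i \<noteq> x $ j"
  using assms unfolding walls_def by auto

lemma J_nonzero_off_walls:
  assumes "x \<in> fund_dom - walls"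
  shows "J x \<noteq> 0"
proof (rule J_nonzero)
  have x: "x \<in> fund_dom" and w: "x \<notin> walls" using assms by auto
  show "0 < x $ i" for i using fund_domD(1)[OF x, of i] not_walls(1)[OF w, of i] by simp
  show "x $ i < 1" for i using fund_domD(2)[OF x, of i] not_walls(2)[OF w, of i] by simp
  show "x $ i \<noteq> x $ j" if "i \<noteq> j" for i j using not_walls(3)[OF w that] .
qed

lemma perm_not_walls:
  assumes "\<sigma> permutes UNIV" "x \<notin> walls"
  shows "perm \<sigma> x \<notin> walls"
proof
  assume "perm \<sigma> x \<in> walls"
  then consider i where "perm \<sigma> x $ i = 0" | i where "perm \<sigma> x $ i = 1"
    | i j where "i \<noteq> j" "perm \<sigma> x $ i = perm \<sigma> x $ j"
    unfolding walls_def by blast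
  then show False
    using not_walls[OF assms(2)] permutes_inj[OF assms(1)] unfolding perm_nth by cases (blast dest: injD)+
qed

lemma H_off_walls:
  assumes "x \<notin> walls"
  shows "H x = 1"
proof -
  have "{\<sigma>. \<sigma> permutes UNIV \<and> (\<chi> i. x $ \<sigma> i) = x} = {id}"
  proof (intro equalityI subsetI)
    fix \<sigma> assume "\<sigma> \<in> {\<sigma>. \<sigma> permutes UNIV \<and> (\<chi> i. x $ \<sigma> i) = x}"
    then have "x $ \<sigma> i = x $ i" for i by (simp add: vec_eq_iff)
    then have "\<sigma> i = i" for i using not_walls(3)[OF assms, of "\<sigma> i" i] by blast
    then show "\<sigma> \<in> {id}" by (simp add: fun_eq_iff)
  qed (simp add: permutes_id)
  then show ?thesis by (simp add: H_def)
qed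

lemma H_pos: "H x > 0"
proof -
  let ?S = "{\<sigma>. \<sigma> permutes UNIV \<and> (\<chi> i. x $ \<sigma> i) = x}"
  have "id \<in> ?S" by (simp add: permutes_id)
  then have "?S \<noteq> {}" by blast
  moreover have "finite ?S"
    by (rule finite_subset[OF _ finite_permutations[of UNIV]]) auto
  ultimately show ?thesis unfolding H_def by (intro card_gt_0_iff[THEN iffD2] conjI)
qed

lemma fund_dom_closed: "closed (fund_dom :: (real^'n::{finite,wellorder}) set)"
proof -
  have "fund_dom = (\<Inter>i. {x::real^'n::_. 0 \<le> x $ i}) \<inter> (\<Inter>i. {x. x $ i \<le> 1})
      \<inter> (\<Inter>(i, j)\<in>{(i, j). i \<le> j}. {x. x $ j \<le> x $ i})"
    unfolding fund_dom_def by blast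
  moreover have "closed \<dots>"
    by (intro closed_Int closed_INT ballI closed_Collect_le continuous_intros, clarify)
       (intro closed_Collect_le continuous_intros)
  ultimately show ?thesis by simp
qed

lemma fund_dom_lebesgue: "fund_dom \<in> sets lebesgue"
  using borel_closed[OF fund_dom_closed] by (intro sets_completionI_sets) simp

abbreviation cube :: "(real^'n::{finite,wellorder}) set" where
  "cube \<equiv> cbox 0 1"

lemma mem_cube: "x \<in> cube \<longleftrightarrow> (\<forall>i. 0 \<le> x $ i \<and> x $ i \<le> 1)"
  by (simp add: mem_box_cart)

lemma fund_dom_subset_cube: "fund_dom \<subseteq> cube"
  by (auto simp: mem_cube dest: fund_domD)

lemma continuous_on_phi: "continuous_on S phi"
  using phi_has_derivative has_derivative_continuous
  by (metis continuous_on_eq_continuous_within)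

lemma continuous_on_peval: "continuous_on S (\<lambda>x. peval f (phi x))"
  unfolding peval_def by (intro continuous_intros continuous_on_phi)

lemma absolutely_integrable_on_fund_dom:
  fixes g :: "real^'n::{finite,wellorder} \<Rightarrow> real"
  assumes "continuous_on UNIV g"
  shows "g absolutely_integrable_on fund_dom"
proof (rule set_integrable_subset)
  show "g absolutely_integrable_on cube"
    by (intro absolutely_integrable_continuous continuous_on_subset[OF assms]) auto
  show "fund_dom \<in> sets lebesgue"
    by (rule fund_dom_lebesgue)
qed (rule fund_dom_subset_cube)

text \<open>The weight is the reciprocal of the Jacobian, so the substitution \<open>Y = phi x\<close> cancels it. The
  two integrands differ at most on the walls, where the weight is 0 by convention.\<close>

lemma weighted_integral_eq_fund_dom:
  fixes f :: "'n::{finite,wellorder} mvpoly"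
  assumes "integral fund_dom (\<lambda>x. peval f (phi x)) = v"
  shows "weighted_integral_eq f v"
proof -
  let ?h = "\<lambda>x. \<bar>det (matrix (\<lambda>h. dphi x *v h))\<bar> * (peval f (phi x) * omegaI (phi x))"
  have eq: "?h x = peval f (phi x)" if "x \<in> fund_dom - walls" for x
  proof -
    have "calJ (phi x) = \<bar>J x\<bar>" using that by (intro calJ_phi) simp
    then show ?thesis using J_nonzero_off_walls[OF that] by (simp add: omegaI_def J_conv_dphi)
  qed
  have "?h absolutely_integrable_on fund_dom"
    by (rule absolutely_integrable_spike[OF absolutely_integrable_on_fund_dom[OF continuous_on_peval] negligible_walls eq])
  moreover have "integral fund_dom (\<lambda>x. peval f (phi x)) = integral fund_dom ?h"
    by (rule integral_spike[OF negligible_walls]) (simp only: eq)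
  then have "integral fund_dom ?h = v" using assms by (simp only:)
  ultimately have "(\<lambda>Y. peval f Y * omegaI Y) absolutely_integrable_on (phi ` fund_dom)
      \<and> integral (phi ` fund_dom) (\<lambda>Y. peval f Y * omegaI Y) = v"
    by (intro has_absolute_integral_change_of_variables_to_real[OF fund_dom_lebesgue
          phi_has_derivative inj_on_phi, THEN iffD1] conjI)
  then show ?thesis
    by (simp add: weighted_integral_eq_def Fimg_def set_lebesgue_integral_eq_integral)
qed

section \<open>Averaging over permutations\<close>

lemma sum_perm_shift:
  assumes "\<sigma> permutes (UNIV::'n::finite set)"
  shows "(\<Sum>\<tau> | \<tau> permutes UNIV. g (perm \<tau> (perm \<sigma> x))) = (\<Sum>\<tau> | \<tau> permutes (UNIV::'n set). g (perm \<tau> x))"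
  unfolding perm_perm
  by (rule setum_permutations_compose_left[OF assms, symmetric])

text \<open>Exactly one vector in the orbit of \<open>x\<close> is decreasing, and it is hit by as many
  permutations as its stabilizer has elements.\<close>

lemma sum_perm_fund_dom:
  fixes x :: "real^'n::{finite,wellorder}"
  assumes "x \<in> cube"
  shows "(\<Sum>\<sigma> | \<sigma> permutes UNIV. indicator fund_dom (perm \<sigma> x) / real (H (perm \<sigma> x))) = 1"
proof -
  obtain \<rho> where \<rho>: "\<rho> permutes (UNIV::'n set)" "\<And>i j. i \<le> j \<Longrightarrow> perm \<rho> x $ j \<le> perm \<rho> x $ i"
    by (rule sorting_perm_exists[of x]) blast
  define z where "z = perm \<rho> x"
  have z: "z \<in> fund_dom"
    using \<rho>(2) assms unfolding z_def fund_dom_def mem_cube by (simp only: mem_Collect_eq perm_nth) blast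
  have iff: "perm \<tau> z \<in> fund_dom \<longleftrightarrow> perm \<tau> z = z" if "\<tau> permutes UNIV" for \<tau>
    using sorted_perm_unique[OF that fund_domD(3)[OF z] fund_domD(3)] z by metis
  have "(\<Sum>\<sigma> | \<sigma> permutes UNIV. indicator fund_dom (perm \<sigma> x) / real (H (perm \<sigma> x)))
      = (\<Sum>\<tau> | \<tau> permutes UNIV. indicator fund_dom (perm \<tau> z) / real (H (perm \<tau> z)))"
    unfolding z_def by (rule sum_perm_shift[OF \<rho>(1), symmetric])
  also have "\<dots> = (\<Sum>\<tau> | \<tau> permutes UNIV. if perm \<tau> z = z then 1 / real (H z) else 0)"
    by (intro sum.cong) (auto simp: iff z)
  also have "\<dots> = (\<Sum>\<tau> | \<tau> permutes UNIV \<and> perm \<tau> z = z. 1 / real (H z))"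
    by (subst sum.inter_filter[symmetric]) (auto simp: finite_permutations)
  also have "\<dots> = real (H z) * (1 / real (H z))"
    by (simp add: H_def perm_def)
  also have "\<dots> = 1" using H_pos[of z] by simp
  finally show ?thesis .
qed

lemma perm_mem_cube: "\<sigma> permutes UNIV \<Longrightarrow> perm \<sigma> x \<in> cube \<longleftrightarrow> x \<in> cube"
  unfolding mem_cube by (metis perm_nth permutes_inverses(1))

text \<open>Insert the factor 1 of the preceding lemma into the sum, exchange the two sums, and move each
  permutation onto the summation variable; the integral over the cube below is treated in the
  same way.\<close>

lemma sum_over_orbits:
  fixes G :: "real^'n::{finite,wellorder} \<Rightarrow> real"
  assumes B: "finite B" "B \<subseteq> cube" and perm_B: "\<And>\<sigma> x. \<sigma> permutes UNIV \<Longrightarrow> x \<in> B \<Longrightarrow> perm \<sigma> x \<in> B"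
    and G: "\<And>\<sigma> x. \<sigma> permutes UNIV \<Longrightarrow> G (perm \<sigma> x) = G x"
  shows "(\<Sum>x\<in>B. G x) = fact CARD('n) * (\<Sum>x\<in>B \<inter> fund_dom. G x / real (H x))"
proof -
  let ?P = "{\<sigma>. \<sigma> permutes (UNIV::'n set)}"
  define h where "h = (\<lambda>x. indicator fund_dom x / real (H x) * G x)"
  have "(\<Sum>x\<in>B. G x) = (\<Sum>x\<in>B. \<Sum>\<sigma>\<in>?P. h (perm \<sigma> x))"
  proof (rule sum.cong[OF refl])
    fix x assume "x \<in> B"
    then have "x \<in> cube" using B by blast
    have "(\<Sum>\<sigma>\<in>?P. h (perm \<sigma> x)) = (\<Sum>\<sigma>\<in>?P. indicator fund_dom (perm \<sigma> x) / real (H (perm \<sigma> x)) * G x)"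
      unfolding h_def by (intro sum.cong refl) (simp only: mem_Collect_eq G)
    also have "\<dots> = 1 * G x"
      unfolding sum_distrib_right[symmetric] sum_perm_fund_dom[OF \<open>x \<in> cube\<close>] ..
    finally show "G x = (\<Sum>\<sigma>\<in>?P. h (perm \<sigma> x))" by simp
  qed
  also have "\<dots> = (\<Sum>\<sigma>\<in>?P. \<Sum>x\<in>B. h (perm \<sigma> x))" by (rule sum.swap)
  also have "\<dots> = (\<Sum>\<sigma>\<in>?P. \<Sum>x\<in>B. h x)"
  proof (rule sum.cong[OF refl])
    fix \<sigma> assume "\<sigma> \<in> ?P"
    then have \<sigma>: "\<sigma> permutes UNIV" by simp
    show "(\<Sum>x\<in>B. h (perm \<sigma> x)) = (\<Sum>x\<in>B. h x)"
      by (rule sum.reindex_bij_witness[of _ "perm (inv \<sigma>)" "perm \<sigma>"])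
         (auto simp: perm_inverse[OF \<sigma>] intro: perm_B \<sigma> permutes_inv)
  qed
  also have "\<dots> = fact CARD('n) * (\<Sum>x\<in>B. h x)"
    using card_permutations[OF refl, of "UNIV::'n set"] by simp
  also have "(\<Sum>x\<in>B. h x) = (\<Sum>x\<in>B \<inter> fund_dom. G x / real (H x))"
    unfolding h_def by (rule sum.mono_neutral_cong_right) (use B in \<open>auto simp: indicator_def\<close>)
  finally show ?thesis .
qed

lemma det_matrix_perm:
  assumes "\<sigma> permutes (UNIV::'n::finite set)"
  shows "\<bar>det (matrix (perm \<sigma> :: real^'n \<Rightarrow> real^'n))\<bar> = 1"
proof -
  have "matrix (perm \<sigma> :: real^'n \<Rightarrow> real^'n) = (\<chi> i. mat 1 $ \<sigma> i)"
    by (simp add: matrix_def vec_eq_iff axis_def mat_def)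
  then show ?thesis
    by (simp add: det_permute_rows[OF assms] abs_mult sign_def)
qed

lemma linear_perm: "linear (perm \<sigma> :: real^'n::finite \<Rightarrow> real^'n)"
  by (intro linearI) (simp_all add: vec_eq_iff)

lemma integral_cube_perm:
  fixes h :: "real^'n::{finite,wellorder} \<Rightarrow> real"
  assumes \<sigma>: "\<sigma> permutes UNIV" and h: "h absolutely_integrable_on cube"
  shows "(\<lambda>x. h (perm \<sigma> x)) absolutely_integrable_on cube \<and>
    integral cube (\<lambda>x. h (perm \<sigma> x)) = integral cube h"
proof -
  have img: "perm \<sigma> ` cube = cube"
  proof (intro equalityI subsetI)
    show "x \<in> perm \<sigma> ` cube" if "x \<in> cube" for x
      using that perm_mem_cube[OF permutes_inv[OF \<sigma>]] perm_inverse(2)[OF \<sigma>] by (metis image_eqI)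
  qed (use perm_mem_cube[OF \<sigma>] in auto)
  have "inj_on (perm \<sigma>) cube"
    by (rule inj_on_inverseI[of _ "perm (inv \<sigma>)"]) (simp add: perm_inverse[OF \<sigma>])
  moreover have "(perm \<sigma> has_derivative perm \<sigma>) (at x within cube)" for x :: "real^'n::_"
    by (intro linear_imp_has_derivative linear_perm)
  ultimately show ?thesis
    using has_absolute_integral_change_of_variables_to_real[of cube "perm \<sigma>" "\<lambda>_. perm \<sigma>" h "integral cube h"] h
    by (simp add: img det_matrix_perm[OF \<sigma>])
qed

lemma integral_cube_symmetric:
  fixes G :: "real^'n::{finite,wellorder} \<Rightarrow> real"
  assumes cont: "continuous_on UNIV G"
    and G: "\<And>\<sigma> x. \<sigma> permutes UNIV \<Longrightarrow> G (perm \<sigma> x) = G x"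
  shows "integral cube G = fact CARD('n) * integral fund_dom G"
proof -
  let ?P = "{\<sigma>. \<sigma> permutes (UNIV::'n set)}"
  define h where "h = (\<lambda>x. if x \<in> fund_dom then G x else 0)"
  have "h absolutely_integrable_on UNIV"
    unfolding h_def absolutely_integrable_restrict_UNIV
    by (rule absolutely_integrable_on_fund_dom[OF cont])
  then have h: "h absolutely_integrable_on cube"
    by (rule set_integrable_subset) auto
  have "integral cube G = integral cube (\<lambda>x. \<Sum>\<sigma>\<in>?P. h (perm \<sigma> x))"
  proof (rule integral_spike[OF negligible_walls])
    fix x :: "real^'n::_" assume x: "x \<in> cube - walls"
    have "H (perm \<sigma> x) = 1" if "\<sigma> permutes UNIV" for \<sigma>
      using x by (intro H_off_walls perm_not_walls that) simp
    then have "(\<Sum>\<sigma>\<in>?P. h (perm \<sigma> x)) = (\<Sum>\<sigma>\<in>?P. indicator fund_dom (perm \<sigma> x) / real (H (perm \<sigma> x)) * G x)"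
      unfolding h_def by (intro sum.cong refl) (simp add: G indicator_def)
    also have "\<dots> = 1 * G x"
      unfolding sum_distrib_right[symmetric] using x by (subst sum_perm_fund_dom) auto
    finally show "(\<Sum>\<sigma>\<in>?P. h (perm \<sigma> x)) = G x" by simp
  qed
  also have "\<dots> = (\<Sum>\<sigma>\<in>?P. integral cube (\<lambda>x. h (perm \<sigma> x)))"
    using integral_cube_perm[OF _ h]
    by (intro integral_sum) (auto simp: finite_permutations dest: set_lebesgue_integral_eq_integral(1))
  also have "\<dots> = (\<Sum>\<sigma>\<in>?P. integral cube h)"
    using integral_cube_perm[OF _ h] by (intro sum.cong) auto
  also have "\<dots> = fact CARD('n) * integral cube h"
    using card_permutations[OF refl, of "UNIV::'n set"] by simp
  also have "integral cube h = integral fund_dom G"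
    unfolding h_def integral_restrict_Int by (simp add: Int_absorb2 fund_dom_subset_cube)
  finally show ?thesis .
qed

section \<open>Product quadrature on the cube\<close>

text \<open>Fubini for products, by the description of Lebesgue measure as the product measure over the
  basis vectors.\<close>

lemma integral_cube_prod:
  fixes g :: "'n::{finite,wellorder} \<Rightarrow> real \<Rightarrow> real"
  assumes cont: "\<And>i. continuous_on UNIV (g i)"
  shows "integral cube (\<lambda>x::real^'n::_. \<Prod>i\<in>UNIV. g i (x $ i)) = (\<Prod>i\<in>UNIV. integral {0..1} (g i))"
proof -
  define e where "e = (\<lambda>i. axis i 1 :: real^'n::_)"
  define f where "f = (\<lambda>i t. indicator {0..1} t * g i t)"
  have e: "bij_betw e UNIV Basis"
    by (auto simp: bij_betw_def inj_on_def e_def axis_eq_axis Basis_vec_def)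
  define f' where "f' = (\<lambda>b. f (inv_into UNIV e b))"
  have f'e: "f' (e i) = f i" for i
    unfolding f'_def using e by (simp add: bij_betw_def)
  have int: "set_integrable lborel {0..1} (g i)" for i
    by (rule borel_integrable_atLeastAtMost') (rule continuous_on_subset[OF cont], simp)
  then have int_f: "integrable lborel (f i)" for i
    unfolding f_def set_integrable_def by simp
  have [measurable]: "g i \<in> borel_measurable borel" for i
    by (rule borel_measurable_continuous_onI[OF cont])
  have [measurable]: "f i \<in> borel_measurable borel" for i
    unfolding f_def by measurable
  have prod_int: "integrable lborel (\<lambda>x::real^'n::_. \<Prod>i\<in>UNIV. f i (x $ i)) \<and>
      (\<integral>x. (\<Prod>i\<in>UNIV. f i (x $ i)) \<partial>(lborel :: (real^'n::_) measure)) = (\<Prod>i\<in>UNIV. \<integral>t. f i t \<partial>lborel)"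
  proof -
    interpret product_sigma_finite "\<lambda>_::real^'n::_. lborel :: real measure" ..
    have meas: "(\<lambda>z. \<Sum>b\<in>Basis. z b *\<^sub>R b) \<in> borel_measurable (\<Pi>\<^sub>M b\<in>(Basis::(real^'n::_) set). lborel)"
      by measurable
    have m: "(\<lambda>x::real^'n::_. \<Prod>i\<in>UNIV. f i (x $ i)) \<in> borel_measurable borel"
      by measurable
    have coord: "(\<Sum>b\<in>Basis. z b *\<^sub>R b :: real^'n::_) $ i = z (e i)" for z :: "real^'n::_ \<Rightarrow> real" and i
    proof -
      have "(\<Sum>b\<in>Basis. z b *\<^sub>R b :: real^'n::_) $ i = (\<Sum>b\<in>Basis. z b *\<^sub>R b) \<bullet> e i"
        by (simp add: e_def inner_axis)
      also have "\<dots> = z (e i)"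
        by (rule inner_sum_left_Basis) (auto simp: e_def)
      finally show ?thesis .
    qed
    have re: "(\<Prod>i\<in>UNIV. f i (z (e i))) = (\<Prod>b\<in>Basis. f' b (z b))" for z
      by (subst prod.reindex_bij_betw[OF e, symmetric]) (simp add: f'e)
    have int': "integrable lborel (f' b)" for b
      unfolding f'_def by (rule int_f)
    have 1: "integrable (\<Pi>\<^sub>M b\<in>(Basis::(real^'n::_) set). lborel) (\<lambda>z. \<Prod>b\<in>Basis. f' b (z b))"
      by (rule product_integrable_prod) (auto intro: int')
    have 2: "(\<integral>z. (\<Prod>b\<in>Basis. f' b (z b)) \<partial>(\<Pi>\<^sub>M b\<in>(Basis::(real^'n::_) set). lborel)) = (\<Prod>b\<in>Basis. \<integral>t. f' b t \<partial>lborel)"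
      by (rule product_integral_prod) (auto intro: int')
    have 3: "(\<Prod>b\<in>Basis. \<integral>t. f' b t \<partial>lborel) = (\<Prod>i\<in>UNIV. \<integral>t. f i t \<partial>lborel)"
      by (subst prod.reindex_bij_betw[OF e, symmetric]) (simp add: f'e)
    show ?thesis
      unfolding lborel_eq[where 'a = "real^'n::_"]
      unfolding integrable_distr_eq[OF meas m] integral_distr[OF meas m] coord re
      using 1 2 3 by simp
  qed
  have "integral cube (\<lambda>x::real^'n::_. \<Prod>i\<in>UNIV. g i (x $ i))
      = integral UNIV (\<lambda>x::real^'n::_. \<Prod>i\<in>UNIV. f i (x $ i))"
  proof -
    have "(\<Prod>i\<in>UNIV. f i (x $ i)) = (if x \<in> cube then \<Prod>i\<in>UNIV. g i (x $ i) else 0)" for x :: "real^'n::_"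
    proof (cases "x \<in> cube")
      case False
      then obtain i where "\<not> (0 \<le> x $ i \<and> x $ i \<le> 1)" unfolding mem_cube by blast
      then have "f i (x $ i) = 0" by (auto simp: f_def)
      then show ?thesis using False by (auto simp: prod_zero_iff)
    qed (simp add: f_def mem_cube)
    then show ?thesis by (simp add: integral_restrict_UNIV)
  qed
  also have "\<dots> = (\<integral>x. (\<Prod>i\<in>UNIV. f i (x $ i)) \<partial>(lborel :: (real^'n::_) measure))"
    using prod_int by (simp add: integral_lborel)
  also have "\<dots> = (\<Prod>i\<in>UNIV. \<integral>t. f i t \<partial>lborel)" using prod_int by simp
  also have "\<dots> = (\<Prod>i\<in>UNIV. integral {0..1} (g i))"
    using set_borel_integral_eq_integral(2)[OF int]
    by (intro prod.cong) (simp_all add: set_lebesgue_integral_def f_def)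
  finally show ?thesis .
qed

lemma sum_grid_prod:
  fixes g :: "'n::finite \<Rightarrow> 'a \<Rightarrow> real"
  assumes "finite A"
  shows "(\<Sum>s | \<forall>i. s $ i \<in> A. \<Prod>i\<in>UNIV. g i (s $ i)) = (\<Prod>i\<in>UNIV. \<Sum>a\<in>A. g i a)"
proof -
  have "(\<Prod>i\<in>UNIV. \<Sum>a\<in>A. g i a) = (\<Sum>r\<in>PiE UNIV (\<lambda>_. A). \<Prod>i\<in>UNIV. g i (r i))"
    by (rule prod_sum_PiE) (use assms in auto)
  also have "\<dots> = (\<Sum>s | \<forall>i. s $ i \<in> A. \<Prod>i\<in>UNIV. g i (s $ i))"
    by (rule sum.reindex_bij_witness[of _ vec_nth vec_lambda]) auto
  finally show ?thesis ..
qed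

lemma finite_grid: "finite A \<Longrightarrow> finite {s :: 'a^'n::finite. \<forall>i. s $ i \<in> A}"
proof -
  assume "finite A"
  then have "finite (vec_lambda ` PiE (UNIV::'n set) (\<lambda>_. A))"
    by (intro finite_imageI finite_PiE) auto
  moreover have "{s :: 'a^'n. \<forall>i. s $ i \<in> A} \<subseteq> vec_lambda ` PiE (UNIV::'n set) (\<lambda>_. A)"
    by (auto intro!: image_eqI[of _ _ "vec_nth _"])
  ultimately show ?thesis by (rule finite_subset[rotated])
qed

text \<open>A polynomial of total degree at most \<open>d\<close> in the fundamental characters has degree at most
  \<open>d\<close> in each single cosine, because every \<open>X j\<close> is multilinear in the cosines.\<close>

inductive cos_span :: "nat \<Rightarrow> (real^'n::finite \<Rightarrow> real) \<Rightarrow> bool" for d where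
  monomial: "(\<And>i. k i \<le> d) \<Longrightarrow> cos_span d (\<lambda>x. \<Prod>i\<in>UNIV. cos (pi * x $ i) ^ k i)"
| lincomb: "cos_span d f \<Longrightarrow> cos_span d g \<Longrightarrow> cos_span d (\<lambda>x. a * f x + b * g x)"

lemma cos_span_const: "cos_span d (\<lambda>x. a)"
  using lincomb[OF monomial monomial, of "\<lambda>_. 0" d "\<lambda>_. 0" a 0] by simp

lemma cos_span_add: "cos_span d f \<Longrightarrow> cos_span d g \<Longrightarrow> cos_span d (\<lambda>x. f x + g x)"
  using lincomb[of d f g 1 1] by simp

lemma cos_span_cmult: "cos_span d f \<Longrightarrow> cos_span d (\<lambda>x. a * f x)"
  using lincomb[of d f f a 0] by simp

lemma cos_span_sum: "(\<And>a. a \<in> A \<Longrightarrow> cos_span d (f a)) \<Longrightarrow> cos_span d (\<lambda>x. \<Sum>a\<in>A. f a x)"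
  by (induction A rule: infinite_finite_induct) (auto intro: cos_span_const cos_span_add)

lemma cos_span_mono: "cos_span d f \<Longrightarrow> d \<le> e \<Longrightarrow> cos_span e f"
  by (induction rule: cos_span.induct) (auto intro: cos_span.intros order_trans)

lemma cos_span_mult:
  assumes "cos_span d f" "cos_span e g"
  shows "cos_span (d + e) (\<lambda>x. f x * g x)"
  using assms(1)
proof (induction rule: cos_span.induct)
  case (monomial k)
  show ?case using assms(2)
  proof (induction rule: cos_span.induct)
    case (monomial l)
    have "cos_span (d + e) (\<lambda>x. \<Prod>i\<in>UNIV. cos (pi * x $ i) ^ (k i + l i))"
      by (intro cos_span.monomial add_mono) (use \<open>\<And>i. k i \<le> d\<close> monomial in auto)
    then show ?case by (simp add: power_add prod.distrib)
  next
    case (lincomb f g a b)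
    from cos_span.lincomb[OF lincomb.IH, of a b] show ?case by (simp add: algebra_simps)
  qed
next
  case (lincomb f g a b)
  from cos_span.lincomb[OF lincomb.IH, of a b] show ?case by (simp add: algebra_simps)
qed

lemma cos_span_power: "cos_span d f \<Longrightarrow> cos_span (d * m) (\<lambda>x. f x ^ m)"
proof (induction m)
  case (Suc m)
  then show ?case using cos_span_mult[of d f "d * m" "\<lambda>x. f x ^ m"] by simp
qed (simp add: cos_span_const)

lemma cos_span_prod:
  "(\<And>i. i \<in> A \<Longrightarrow> cos_span (e i) (f i)) \<Longrightarrow> cos_span (\<Sum>i\<in>A. e i) (\<lambda>x. \<Prod>i\<in>A. f i x)"
  by (induction A rule: infinite_finite_induct) (auto intro: cos_span_const cos_span_mult)

lemma cos_span_X: "cos_span 1 (X j)"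
proof -
  have "cos_span 1 (\<lambda>x::real^'a::_. \<Prod>i\<in>UNIV. cos (pi * (\<chi> i. if i \<le> j then 1 else 0) $ \<sigma> i * x $ i))" for \<sigma>
  proof -
    have "(\<Prod>i\<in>UNIV. cos (pi * (\<chi> i. if i \<le> j then 1 else 0) $ \<sigma> i * x $ i))
        = (\<Prod>i\<in>UNIV. cos (pi * x $ i) ^ (if \<sigma> i \<le> j then 1 else 0))" for x :: "real^'a::_"
      by (rule prod.cong) auto
    then show ?thesis
      using cos_span.monomial[of "\<lambda>i. if \<sigma> i \<le> j then 1 else 0" 1] by simp
  qed
  then show ?thesis
    unfolding X_def cos_plus_def by (rule cos_span_sum)
qed

lemma total_degree_ge: "m \<in> Poly_Mapping.keys f \<Longrightarrow> (\<Sum>i\<in>UNIV. Poly_Mapping.lookup m i) \<le> total_degree f"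
  unfolding total_degree_def by (rule Max_ge) auto

lemma cos_span_peval_phi: "total_degree f \<le> d \<Longrightarrow> cos_span d (\<lambda>x. peval f (phi x))"
  unfolding peval_def
proof (intro cos_span_sum cos_span_cmult)
  fix m assume m: "m \<in> Poly_Mapping.keys f" and d: "total_degree f \<le> d"
  have "cos_span (\<Sum>j\<in>UNIV. 1 * Poly_Mapping.lookup m j) (\<lambda>x. \<Prod>j\<in>UNIV. X j x ^ Poly_Mapping.lookup m j)"
    by (intro cos_span_prod cos_span_power cos_span_X)
  then have "cos_span d (\<lambda>x. \<Prod>j\<in>UNIV. X j x ^ Poly_Mapping.lookup m j)"
    by (rule cos_span_mono) (use total_degree_ge[OF m] d in simp)
  then show "cos_span d (\<lambda>x. \<Prod>j\<in>UNIV. phi x $ j ^ Poly_Mapping.lookup m j)"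
    by (simp add: phi_def)
qed

definition quadrature :: "real set \<Rightarrow> (real \<Rightarrow> real) \<Rightarrow> nat \<Rightarrow> bool" where
  "quadrature A w d \<longleftrightarrow> finite A \<and> A \<subseteq> {0..1} \<and>
     (\<forall>k\<le>d. (\<Sum>a\<in>A. w a * cos (pi * a) ^ k) = integral {0..1} (\<lambda>t. cos (pi * t) ^ k))"

lemma cos_span_continuous: "cos_span d g \<Longrightarrow> continuous_on S g"
  by (induction rule: cos_span.induct) (intro continuous_intros; assumption)+

lemma product_quadrature:
  fixes g :: "real^'n::{finite,wellorder} \<Rightarrow> real"
  assumes "quadrature A w d" "cos_span d g"
  shows "integral cube g = (\<Sum>s | \<forall>i. s $ i \<in> A. (\<Prod>i\<in>UNIV. w (s $ i)) * g s)"
  using assms(2)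
proof (induction rule: cos_span.induct)
  case (monomial k)
  have "integral cube (\<lambda>x::real^'n::_. \<Prod>i\<in>UNIV. cos (pi * x $ i) ^ k i)
      = (\<Prod>i\<in>UNIV. integral {0..1} (\<lambda>t. cos (pi * t) ^ k i))"
    by (rule integral_cube_prod) (intro continuous_intros)
  also have "\<dots> = (\<Prod>i\<in>UNIV. \<Sum>a\<in>A. w a * cos (pi * a) ^ k i)"
    using assms(1) monomial by (simp add: quadrature_def)
  also have "\<dots> = (\<Sum>s | \<forall>i. s $ i \<in> A. \<Prod>i\<in>UNIV. w (s $ i) * cos (pi * s $ i) ^ k i)"
    using assms(1) by (intro sum_grid_prod[symmetric]) (simp add: quadrature_def)
  finally show ?case by (simp add: prod.distrib)
next
  case (lincomb f g a b)
  have "f integrable_on cube" "g integrable_on cube"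
    using lincomb.hyps by (auto intro!: integrable_continuous cos_span_continuous)
  then have "integral cube (\<lambda>x. a * f x + b * g x) = a * integral cube f + b * integral cube g"
    by (subst integral_add) (auto intro: integrable_on_mult_right)
  then show ?case
    by (simp add: lincomb.IH sum_distrib_left sum.distrib algebra_simps)
qed

text \<open>A product rule on the cube, applied to a symmetric integrand, restricts to the fundamental
  domain: the factor \<open>n!\<close> appears on both sides, and the stabilizers account for the nodes
  on the walls.\<close>

lemma cubature_on_fund_dom:
  fixes f :: "'n::{finite,wellorder} mvpoly"
  assumes q: "quadrature A w d" and f: "total_degree f \<le> d"
  shows "weighted_integral_eq f
    (\<Sum>s | (\<forall>i. s $ i \<in> A) \<and> s \<in> fund_dom.
       (\<Prod>i\<in>UNIV. w (s $ i)) * inverse (real (H s)) * peval f (phi s))"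
proof (rule weighted_integral_eq_fund_dom)
  let ?B = "{s :: real^'n::_. \<forall>i. s $ i \<in> A}"
  let ?g = "\<lambda>x. peval f (phi x)"
  let ?G = "\<lambda>s. (\<Prod>i\<in>UNIV. w (s $ i)) * ?g s"
  have A: "finite A" "A \<subseteq> {0..1}" using q by (simp_all add: quadrature_def)
  have "fact CARD('n) * integral fund_dom ?g = integral cube ?g"
    by (rule integral_cube_symmetric[symmetric]) (auto simp: phi_perm intro: continuous_on_peval)
  also have "\<dots> = (\<Sum>s\<in>?B. ?G s)"
    by (rule product_quadrature[OF q cos_span_peval_phi[OF f]])
  also have "\<dots> = fact CARD('n) * (\<Sum>s\<in>?B \<inter> fund_dom. ?G s / real (H s))"
  proof (rule sum_over_orbits)
    show "?B \<subseteq> cube" using A(2) by (fastforce simp: mem_cube)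
    fix \<sigma> :: "'n \<Rightarrow> 'n" and s :: "real^'n::_" assume \<sigma>: "\<sigma> permutes UNIV"
    have "(\<Prod>i\<in>UNIV. w (s $ \<sigma> i)) = (\<Prod>i\<in>UNIV. w (s $ i))"
      by (rule prod.permute[OF \<sigma>, symmetric, unfolded o_def])
    then show "?G (perm \<sigma> s) = ?G s" by (simp add: phi_perm[OF \<sigma>])
  qed (use finite_grid[OF A(1)] in auto)
  finally show "integral fund_dom ?g = (\<Sum>s | (\<forall>i. s $ i \<in> A) \<and> s \<in> fund_dom.
       (\<Prod>i\<in>UNIV. w (s $ i)) * inverse (real (H s)) * peval f (phi s))"
    by (simp add: Int_def divide_inverse mult_ac)
qed

section \<open>Quadrature rules in one variable\<close>

lemma integral_cos_pi: "integral {0..1} (\<lambda>t. cos (pi * real j * t)) = (if j = 0 then 1 else 0)"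
proof (cases "j = 0")
  case False
  have "((\<lambda>t. cos (pi * real j * t)) has_integral
      (sin (pi * real j * 1) / (pi * real j) - sin (pi * real j * 0) / (pi * real j))) {0..1}"
    using False
    by (intro fundamental_theorem_of_calculus)
       (auto intro!: derivative_eq_intros simp flip: has_real_derivative_iff_has_vector_derivative)
  then show ?thesis using False by (simp add: integral_unique mult.commute[of pi])
qed simp

text \<open>Powers of the cosine are spanned by cosines of multiples, so it is enough to test a rule on
  the latter.\<close>

lemma quadratureI:
  assumes A: "finite A" "A \<subseteq> {0..1}"
    and total: "(\<Sum>a\<in>A. w a) = 1"
    and vanish: "\<And>j. 1 \<le> j \<Longrightarrow> j \<le> d \<Longrightarrow> (\<Sum>a\<in>A. w a * cos (pi * real j * a)) = 0"
  shows "quadrature A w d"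
proof -
  have "(\<Sum>a\<in>A. w a * (cos (pi * a) ^ k * cos (pi * real j * a)))
      = integral {0..1} (\<lambda>t. cos (pi * t) ^ k * cos (pi * real j * t))" if "k + j \<le> d" for k j
    using that
  proof (induction k arbitrary: j)
    case 0
    then show ?case using total vanish[of j] by (cases "j = 0") (simp_all add: integral_cos_pi)
  next
    case (Suc k)
    show ?case
    proof (cases j)
      case 0
      then show ?thesis using Suc.IH[of 1] Suc.prems by (simp add: mult.commute)
    next
      case (Suc i)
      let ?f = "\<lambda>j t. cos (pi * t) ^ k * cos (pi * real j * t)"
      have eq: "cos (pi * t) ^ Suc k * cos (pi * real j * t) = 1/2 * ?f (Suc j) t + 1/2 * ?f i t" for t
      proof -
        have e: "pi * real (Suc j) * t = pi * real j * t + pi * t" "pi * real i * t = pi * real j * t - pi * t"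
          using Suc by (simp_all add: algebra_simps)
        show ?thesis unfolding e cos_add cos_diff by (simp add: field_simps)
      qed
      have int: "?f j integrable_on {0..1}" for j
        by (intro integrable_continuous_real continuous_intros)
      have "integral {0..1} (\<lambda>t. 1/2 * ?f (Suc j) t + 1/2 * ?f i t)
          = 1/2 * integral {0..1} (?f (Suc j)) + 1/2 * integral {0..1} (?f i)"
        using int[of "Suc j"] int[of i]
        by (subst integral_add) (auto intro: integrable_on_mult_right)
      moreover have "(\<Sum>a\<in>A. w a * (1/2 * ?f (Suc j) a + 1/2 * ?f i a))
          = 1/2 * (\<Sum>a\<in>A. w a * ?f (Suc j) a) + 1/2 * (\<Sum>a\<in>A. w a * ?f i a)"
        by (simp add: sum_distrib_left sum.distrib algebra_simps)
      ultimately show ?thesis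
        unfolding eq using Suc.IH[of "Suc j"] Suc.IH[of i] Suc.prems \<open>j = Suc i\<close> by simp
    qed
  qed
  from this[of _ 0] show ?thesis using A by (simp add: quadrature_def)
qed

text \<open>Multiplication by \<open>sin h\<close> makes the sums of cosines over the three kinds of nodes telescope;
  \<open>2 * h\<close> is the step between consecutive angles.\<close>

lemma sin_times_trapezoid_sum:
  "sin h * (\<Sum>r<m. cos (2 * real r * h) + cos (2 * (real r + 1) * h)) = cos h * sin (2 * real m * h)"
proof (induction m)
  case (Suc m)
  have e: "2 * real m * h = (2 * real m + 1) * h - h" "2 * (real m + 1) * h = (2 * real m + 1) * h + h"
    "2 * real (Suc m) * h = (2 * real m + 1) * h + h"
    by (simp_all add: algebra_simps)
  have "sin h * (cos (\<alpha> - h) + cos (\<alpha> + h)) = cos h * sin (\<alpha> + h) - cos h * sin (\<alpha> - h)" for \<alpha>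
    by (simp add: sin_add sin_diff cos_add cos_diff algebra_simps)
  then have "sin h * (cos (2 * real m * h) + cos (2 * (real m + 1) * h))
      = cos h * sin (2 * real (Suc m) * h) - cos h * sin (2 * real m * h)"
    unfolding e .
  then show ?case using Suc by (simp only: sum.lessThan_Suc distrib_left)
qed simp

lemma sin_times_cos_sum:
  "2 * sin h * (\<Sum>r<m. cos (2 * real r * h)) = sin ((2 * real m - 1) * h) + sin h"
proof (induction m)
  case (Suc m)
  have e: "(2 * real (Suc m) - 1) * h = 2 * real m * h + h" "(2 * real m - 1) * h = 2 * real m * h - h"
    by (simp_all add: algebra_simps)
  have "2 * sin h * cos (2 * real m * h) = sin ((2 * real (Suc m) - 1) * h) - sin ((2 * real m - 1) * h)"
    unfolding e sin_add sin_diff by simp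
  then show ?case using Suc by (simp only: sum.lessThan_Suc distrib_left)
qed simp

lemma sin_times_shifted_cos_sum:
  "2 * sin h * (\<Sum>r<m. cos ((2 * real r + 1) * h)) = sin (2 * real m * h)"
proof (induction m)
  case (Suc m)
  have e: "2 * real m * h = (2 * real m + 1) * h - h" "2 * real (Suc m) * h = (2 * real m + 1) * h + h"
    by (simp_all add: algebra_simps)
  have "2 * sin h * cos ((2 * real m + 1) * h) = sin (2 * real (Suc m) * h) - sin (2 * real m * h)"
    unfolding e sin_add sin_diff by simp
  then show ?case using Suc by (simp only: sum.lessThan_Suc distrib_left)
qed simp

lemma sum_c_trapezoid:
  assumes "N \<ge> 1"
  shows "(\<Sum>r<N + 1. c N (int r) * g r) = (\<Sum>r<N. g r + g (Suc r)) / 2"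
proof -
  have "(\<Sum>r<N + 1. c N (int r) * g r)
      = (\<Sum>r<N + 1. g r - (if r = 0 then g r / 2 else 0) - (if r = N then g r / 2 else 0))"
    using assms by (intro sum.cong) (auto simp: c_def)
  also have "\<dots> = (\<Sum>r<Suc N. g r) - g 0 / 2 - g N / 2"
    using assms by (simp add: sum_subtractf sum.delta)
  also have "\<dots> = ((\<Sum>r<Suc N. g r) - g N) / 2 + ((\<Sum>r<Suc N. g r) - g 0) / 2"
    by (simp add: field_simps)
  also have "(\<Sum>r<Suc N. g r) - g N = (\<Sum>r<N. g r)" by simp
  also have "(\<Sum>r<Suc N. g r) - g 0 = (\<Sum>r<N. g (Suc r))"
    by (subst sum.lessThan_Suc_shift) simp
  finally show ?thesis by (simp add: sum.distrib field_simps)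
qed

lemma sum_c_left:
  assumes "N \<ge> 1"
  shows "(\<Sum>r<N. c N (int r) * g r) = (\<Sum>r<N. g r) - g 0 / 2"
proof -
  have "(\<Sum>r<N. c N (int r) * g r) = (\<Sum>r<N. g r - (if r = 0 then g r / 2 else 0))"
    using assms by (intro sum.cong) (auto simp: c_def)
  then show ?thesis using assms by (simp add: sum_subtractf sum.delta)
qed

lemma sum_c_right:
  assumes "N \<ge> 1"
  shows "(\<Sum>r<N. c N (int r + 1) * g r) = (\<Sum>r<N. g r) - g (N - 1) / 2"
proof -
  have "(\<Sum>r<N. c N (int r + 1) * g r) = (\<Sum>r<N. g r - (if r = N - 1 then g r / 2 else 0))"
    using assms by (intro sum.cong) (auto simp: c_def)
  then show ?thesis using assms by (simp add: sum_subtractf sum.delta)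
qed

lemma sin_pi_fraction_pos:
  assumes "0 < x" "x < (y::real)"
  shows "sin (pi * x / y) > 0"
  using assms by (intro sin_gt_zero) (auto simp: field_simps)

text \<open>Aliasing sets in at frequency \<open>2 * N\<close>, where \<open>sin h\<close> vanishes: all nodes then see the constant
  function 1.\<close>

lemma trapezoid_rule_vanishes:
  assumes "N \<ge> 1" "1 \<le> j" "j \<le> 2 * N - 1"
  shows "(\<Sum>r<N + 1. c N (int r) * cos (pi * real j * (real r / real N))) = 0"
proof -
  define h where "h = pi * real j / (2 * real N)"
  have "sin h > 0"
    unfolding h_def using assms by (intro sin_pi_fraction_pos) linarith+
  moreover have "sin (2 * real N * h) = 0"
  proof -
    have "2 * real N * h = real j * pi" using assms by (simp add: h_def)
    then show ?thesis by simp
  qed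
  ultimately have "(\<Sum>r<N. cos (2 * real r * h) + cos (2 * (real r + 1) * h)) = 0"
    using sin_times_trapezoid_sum[of h N] by simp
  moreover have "pi * real j * (real r / real N) = 2 * real r * h" for r
    using assms by (simp add: h_def field_simps)
  ultimately show ?thesis
    using sum_c_trapezoid[OF assms(1), of "\<lambda>r. cos (2 * real r * h)"] by (simp add: add.commute)
qed

text \<open>The nodes are one half, up to reflection, of \<open>2 * N - 1\<close> equally spaced points on the circle of
  length 2; the weight \<open>1/2\<close> belongs to the single point fixed by the reflection, which is 0 in the
  first rule and 1 in the second.\<close>

lemma odd_rules_vanish:
  assumes "N \<ge> 1" "1 \<le> j" "j \<le> 2 * (N - 1)"
  shows "(\<Sum>r<N. c N (int r) * cos (pi * real j * (2 * real r / (2 * real N - 1)))) = 0"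
    and "(\<Sum>r<N. c N (int r + 1) * cos (pi * real j * (2 * (real r + 1/2) / (2 * real N - 1)))) = 0"
proof -
  define h where "h = pi * real j / (2 * real N - 1)"
  have N: "2 * real N - 1 > 0" "real j < 2 * real N - 1"
    using assms by linarith+
  have sin: "sin h > 0"
    unfolding h_def using assms N by (intro sin_pi_fraction_pos) auto
  have hN: "(2 * real N - 1) * h = real j * pi" using N by (simp add: h_def)
  have "2 * sin h * ((\<Sum>r<N. cos (2 * real r * h)) - 1/2) = 0"
    using sin_times_cos_sum[of h N] unfolding hN by (simp add: algebra_simps)
  then have "(\<Sum>r<N. cos (2 * real r * h)) - 1/2 = 0" using sin by simp
  moreover have "pi * real j * (2 * real r / (2 * real N - 1)) = 2 * real r * h" for r
    by (simp add: h_def field_simps)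
  ultimately show "(\<Sum>r<N. c N (int r) * cos (pi * real j * (2 * real r / (2 * real N - 1)))) = 0"
    using sum_c_left[OF assms(1), of "\<lambda>r. cos (2 * real r * h)"] by simp
  have "2 * real N * h = real j * pi + h" using hN by (simp add: algebra_simps)
  then have "2 * sin h * ((\<Sum>r<N. cos ((2 * real r + 1) * h)) - cos (real j * pi) / 2) = 0"
    using sin_times_shifted_cos_sum[of h N] by (simp add: sin_add algebra_simps)
  then have "(\<Sum>r<N. cos ((2 * real r + 1) * h)) - cos (real j * pi) / 2 = 0" using sin by simp
  moreover have "(2 * real (N - 1) + 1) * h = real j * pi"
    using assms hN by (simp add: of_nat_diff)
  moreover have "pi * real j * (2 * (real r + 1/2) / (2 * real N - 1)) = (2 * real r + 1) * h" for r
  proof -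
    have e: "2 * (real r + 1/2) = 2 * real r + 1" by simp
    show ?thesis unfolding e h_def by (simp add: mult_ac)
  qed
  ultimately show "(\<Sum>r<N. c N (int r + 1) * cos (pi * real j * (2 * (real r + 1/2) / (2 * real N - 1)))) = 0"
    using sum_c_right[OF assms(1), of "\<lambda>r. cos ((2 * real r + 1) * h)"] by simp
qed

section \<open>Cubature on the labelled grids\<close>

text \<open>Both \<open>phi\<close> and the labelling are injective, so a sum over the points \<open>Y\<close> of the image grid is
  a sum over the labels, and the inverses in the weights undo the labelling. The sequence
  \<open>a\<close> gives the nodes and \<open>K * w\<close> the weights in one variable.\<close>

lemma cubature_on_grid:
  fixes a w :: "int \<Rightarrow> real" and pt :: "int^'n::{finite,wellorder} \<Rightarrow> real^'n::_" and f :: "'n mvpoly"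
  assumes a: "strict_mono a" and nodes: "\<And>r. 0 \<le> r \<Longrightarrow> r < int M \<Longrightarrow> 0 \<le> a r \<and> a r \<le> 1"
    and pt: "\<And>r i. pt r $ i = a (r $ i)"
    and total: "(\<Sum>r<M. K * w (int r)) = 1"
    and vanish: "\<And>j. 1 \<le> j \<Longrightarrow> j \<le> d \<Longrightarrow> (\<Sum>r<M. w (int r) * cos (pi * real j * a (int r))) = 0"
    and E: "\<And>Y. E Y = (\<Prod>i\<in>UNIV. w (inv_into (D M) (\<lambda>r. phi (pt r)) Y $ i))"
    and f: "total_degree f \<le> d"
  shows "weighted_integral_eq f
    (K ^ CARD('n) * (\<Sum>Y\<in>phi ` pt ` D M. E Y * inverse (real (calH Y)) * peval f Y))"
proof -
  define A where "A = (\<lambda>r. a (int r)) ` {..<M}"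
  define v where "v = (\<lambda>x. K * w (inv a x))"
  have inj_a: "inj a" by (rule strict_mono_imp_inj_on[OF a])
  have inj: "inj_on (\<lambda>r. a (int r)) {..<M}"
    by (intro inj_onI) (metis injD inj_a of_nat_eq_iff)
  have v_a: "v (a r) = K * w r" for r by (simp add: v_def inv_f_f[OF inj_a])
  have mem_A: "a r \<in> A \<longleftrightarrow> 0 \<le> r \<and> r < int M" for r
  proof
    assume "a r \<in> A"
    then show "0 \<le> r \<and> r < int M" using inj_a by (auto simp: A_def inj_eq)
  next
    assume "0 \<le> r \<and> r < int M"
    then show "a r \<in> A" unfolding A_def by (intro image_eqI[of _ _ "nat r"]) auto
  qed
  have q: "quadrature A v d"
  proof (rule quadratureI)
    show "finite A" by (simp add: A_def)
    show "A \<subseteq> {0..1}" using nodes by (auto simp: A_def)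
    show "(\<Sum>x\<in>A. v x) = 1"
      unfolding A_def by (subst sum.reindex[OF inj]) (simp add: v_a total)
    show "(\<Sum>x\<in>A. v x * cos (pi * real j * x)) = 0" if "1 \<le> j" "j \<le> d" for j
      unfolding A_def
      by (subst sum.reindex[OF inj])
         (use vanish[OF that] in \<open>simp add: v_a mult.assoc flip: sum_distrib_left\<close>)
  qed
  have inj_pt: "inj pt"
    by (rule injI) (metis inj_a inj_eq pt vec_eq_iff)
  have grid: "{s. (\<forall>i. s $ i \<in> A) \<and> s \<in> fund_dom} = pt ` D M"
  proof (intro equalityI subsetI)
    fix s :: "real^'n::_" assume s: "s \<in> {s. (\<forall>i. s $ i \<in> A) \<and> s \<in> fund_dom}"
    define r where "r = (\<chi> i. inv a (s $ i))"
    have "s $ i \<in> range a" for i using s by (auto simp: A_def)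
    then have ar: "a (r $ i) = s $ i" for i by (simp add: r_def f_inv_into_f)
    have "r \<in> D M"
      unfolding D_def
    proof (intro CollectI conjI allI impI)
      fix i j
      have "a (r $ i) \<in> A" using s by (simp add: ar)
      then show "0 \<le> r $ i" "r $ i \<le> int M - 1" by (auto simp: mem_A)
      assume "i \<le> j"
      then have "a (r $ j) \<le> a (r $ i)" using s by (simp add: ar fund_domD(3))
      then show "r $ j \<le> r $ i" using a by (simp add: strict_mono_less_eq)
    qed
    moreover have "s = pt r" by (simp add: vec_eq_iff pt ar)
    ultimately show "s \<in> pt ` D M" by blast
  next
    fix s :: "real^'n::_" assume "s \<in> pt ` D M"
    then obtain r where r: "r \<in> D M" "s = pt r" by blast
    have r1: "0 \<le> r $ i" "r $ i < int M" for i using r(1) unfolding D_def by auto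
    have r2: "i \<le> j \<Longrightarrow> r $ j \<le> r $ i" for i j using r(1) unfolding D_def by auto
    have "s \<in> fund_dom"
      unfolding fund_dom_def
      using nodes[OF r1] strict_mono_less_eq[OF a] r2 by (simp add: r(2) pt)
    then show "s \<in> {s. (\<forall>i. s $ i \<in> A) \<and> s \<in> fund_dom}"
      using r1 by (simp add: r(2) pt mem_A)
  qed
  have dom: "pt r \<in> fund_dom" if "r \<in> D M" for r using that grid by blast
  have inj_phi_pt: "inj_on (\<lambda>r. phi (pt r)) (D M)"
  proof (rule inj_onI)
    fix r s assume r: "r \<in> D M" and s: "s \<in> D M" and "phi (pt r) = phi (pt s)"
    then have "pt r = pt s" by (intro inj_onD[OF inj_on_phi _ dom dom])
    then show "r = s" by (rule injD[OF inj_pt])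
  qed
  have summand: "(\<Prod>i\<in>UNIV. v (pt r $ i)) * inverse (real (H (pt r))) * peval f (phi (pt r))
      = K ^ CARD('n) * (E (phi (pt r)) * inverse (real (calH (phi (pt r)))) * peval f (phi (pt r)))"
    if r: "r \<in> D M" for r
  proof -
    have "calH (phi (pt r)) = H (pt r)"
      by (simp add: calH_def inv_into_f_f[OF inj_on_phi dom[OF r]])
    moreover have "E (phi (pt r)) = (\<Prod>i\<in>UNIV. w (r $ i))"
      using inv_into_f_f[OF inj_phi_pt r] by (simp add: E)
    ultimately show ?thesis by (simp add: pt v_a prod.distrib)
  qed
  have "(\<Sum>s | (\<forall>i. s $ i \<in> A) \<and> s \<in> fund_dom.
       (\<Prod>i\<in>UNIV. v (s $ i)) * inverse (real (H s)) * peval f (phi s))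
    = (\<Sum>r\<in>D M. K ^ CARD('n) * (E (phi (pt r)) * inverse (real (calH (phi (pt r)))) * peval f (phi (pt r))))"
    unfolding grid
    by (subst sum.reindex[OF inj_on_subset[OF inj_pt subset_UNIV]]) (simp only: o_def summand cong: sum.cong)
  also have "\<dots> = K ^ CARD('n) * (\<Sum>Y\<in>phi ` pt ` D M. E Y * inverse (real (calH Y)) * peval f Y)"
    unfolding image_image sum_distrib_left[symmetric] by (subst sum.reindex[OF inj_phi_pt]) simp
  finally show ?thesis using cubature_on_fund_dom[OF q f] by (simp only:)
qed

theorem mainTheorem12:
  shows "(\<forall>(N::nat) (f :: 'n::{finite,wellorder} mvpoly).
            N \<ge> 1 \<and> total_degree f \<le> 2 * N - 1 \<longrightarrow>
            weighted_integral_eq f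
              ((1 / real N) ^ CARD('n) *
                (\<Sum>Y\<in>phi ` gridI N. calE_I N Y * inverse (real (calH Y)) * peval f Y))) \<and>
         (\<forall>(N::nat) (f :: 'n mvpoly).
            N \<ge> 2 \<and> total_degree f \<le> 2 * (N - 1) \<longrightarrow>
            weighted_integral_eq f
              ((2 / (2 * real N - 1)) ^ CARD('n) *
                (\<Sum>Y\<in>phi ` gridV N. calE_V N Y * inverse (real (calH Y)) * peval f Y)) \<and>
            weighted_integral_eq f
              ((2 / (2 * real N - 1)) ^ CARD('n) *
                (\<Sum>Y\<in>phi ` gridVI N. calE_VI N Y * inverse (real (calH Y)) * peval f Y)))"
proof (intro conjI allI impI; elim conjE)
  fix N :: nat and f :: "'n mvpoly"
  assume N: "N \<ge> 1" and f: "total_degree f \<le> 2 * N - 1"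
  show "weighted_integral_eq f ((1 / real N) ^ CARD('n) *
      (\<Sum>Y\<in>phi ` gridI N. calE_I N Y * inverse (real (calH Y)) * peval f Y))"
    unfolding gridI_def
  proof (rule cubature_on_grid[where a = "\<lambda>r. of_int r / real N" and w = "c N" and d = "2 * N - 1"])
    show "strict_mono (\<lambda>r. of_int r / real N)"
      using N by (intro strict_monoI) (simp add: divide_strict_right_mono)
    show "(\<Sum>r<N + 1. 1 / real N * c N (int r)) = 1"
      using sum_c_trapezoid[OF N, of "\<lambda>_. 1"] N by (simp flip: sum_distrib_left sum_divide_distrib)
    show "(\<Sum>r<N + 1. c N (int r) * cos (pi * real j * (of_int (int r) / real N))) = 0"
      if "1 \<le> j" "j \<le> 2 * N - 1" for j
      using trapezoid_rule_vanishes[OF N that] by simp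
  qed (use N f in \<open>auto simp: ptI_def calE_I_def Let_def field_simps\<close>)
next
  fix N :: nat and f :: "'n mvpoly"
  assume N: "N \<ge> 2" and f: "total_degree f \<le> 2 * (N - 1)"
  have N1: "N \<ge> 1" and N2: "2 * real N - 1 > 0" using N by linarith+
  show "weighted_integral_eq f ((2 / (2 * real N - 1)) ^ CARD('n) *
      (\<Sum>Y\<in>phi ` gridV N. calE_V N Y * inverse (real (calH Y)) * peval f Y))"
    unfolding gridV_def
  proof (rule cubature_on_grid[where a = "\<lambda>r. 2 * of_int r / (2 * real N - 1)" and w = "c N" and d = "2 * (N - 1)"])
    show "strict_mono (\<lambda>r. 2 * of_int r / (2 * real N - 1))"
      using N2 by (intro strict_monoI) (simp add: divide_strict_right_mono)
    show "(\<Sum>r<N. 2 / (2 * real N - 1) * c N (int r)) = 1"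
      unfolding sum_distrib_left[symmetric] using sum_c_left[OF N1, of "\<lambda>_. 1"] N2 by (simp add: field_simps)
    show "(\<Sum>r<N. c N (int r) * cos (pi * real j * (2 * of_int (int r) / (2 * real N - 1)))) = 0"
      if "1 \<le> j" "j \<le> 2 * (N - 1)" for j
      using odd_rules_vanish(1)[OF N1 that] by simp
    show "0 \<le> 2 * of_int r / (2 * real N - 1) \<and> 2 * of_int r / (2 * real N - 1) \<le> 1"
      if "0 \<le> r" "r < int N" for r
    proof -
      have "real_of_int r \<le> real N - 1" using that by linarith
      then show ?thesis using N2 that by simp
    qed
  qed (use f in \<open>auto simp: ptV_def calE_V_def Let_def\<close>)
  show "weighted_integral_eq f ((2 / (2 * real N - 1)) ^ CARD('n) *
      (\<Sum>Y\<in>phi ` gridVI N. calE_VI N Y * inverse (real (calH Y)) * peval f Y))"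
    unfolding gridVI_def
  proof (rule cubature_on_grid[where a = "\<lambda>r. 2 * (of_int r + 1/2) / (2 * real N - 1)"
        and w = "\<lambda>r. c N (r + 1)" and d = "2 * (N - 1)"])
    show "strict_mono (\<lambda>r. 2 * (of_int r + 1/2) / (2 * real N - 1))"
      using N2 by (intro strict_monoI) (simp add: divide_strict_right_mono)
    show "(\<Sum>r<N. 2 / (2 * real N - 1) * c N (int r + 1)) = 1"
      unfolding sum_distrib_left[symmetric] using sum_c_right[OF N1, of "\<lambda>_. 1"] N2 by (simp add: field_simps)
    show "(\<Sum>r<N. c N (int r + 1) * cos (pi * real j * (2 * (of_int (int r) + 1/2) / (2 * real N - 1)))) = 0"
      if "1 \<le> j" "j \<le> 2 * (N - 1)" for j
      using odd_rules_vanish(2)[OF N1 that] by simp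
    show "0 \<le> 2 * (of_int r + 1/2) / (2 * real N - 1) \<and> 2 * (of_int r + 1/2) / (2 * real N - 1) \<le> 1"
      if "0 \<le> r" "r < int N" for r
    proof -
      have "real_of_int r \<le> real N - 1" using that by linarith
      then show ?thesis using N2 that by simp
    qed
  qed (use f in \<open>auto simp: ptVI_def calE_VI_def Let_def\<close>)
qed

end
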